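(* Let $G$ be a finite group and suppose given integers $n(H,\phi)$ for all pairs $(H,\phi)$ with $H$ either a cyclic subgroup of $G$ or $H=G$, and $\phi$ a character of $H$, satisfying: (i) $n(H,\phi_1+\phi_2)=n(H,\phi_1)+n(H,\phi_2)$ for all characters $\phi_1,\phi_2$ of such $H$; (ii) $n(G,\mathrm{Ind}_H^G\phi)=n(H,\phi)$ for every cyclic subgroup $H$ and every character $\phi$ of $H$; (iii) $n(H,\phi)\ge0$ for every cyclic subgroup $H$ and every character $\phi$ of $H$. Then \[\sum_{\chi\in\mathrm{Irr}(G)}n(G,\chi)^2\le n(G,\mathrm{Reg}_G)^2.\]
   Context: $\mathrm{Irr}(G)$ is the set of irreducible complex characters of $G$, and $\mathrm{Reg}_G=\sum_{\chi\in\mathrm{Irr}(G)}\chi(1)\chi$ is the regular character. $\mathrm{Ind}_H^G$ denotes induction of characters. *)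

theory Defs
  imports "HOL-Algebra.Generated_Groups" "Jordan_Normal_Form.Matrix"
begin

definition is_rep :: "('a, 'b) monoid_scheme \<Rightarrow> nat \<Rightarrow> ('a \<Rightarrow> complex mat) \<Rightarrow> bool" where
  "is_rep G d \<rho> \<longleftrightarrow>
     (\<forall>g\<in>carrier G. \<rho> g \<in> carrier_mat d d) \<and>
     \<rho> \<one>\<^bsub>G\<^esub> = 1\<^sub>m d \<and>
     (\<forall>g\<in>carrier G. \<forall>h\<in>carrier G. \<rho> (g \<otimes>\<^bsub>G\<^esub> h) = \<rho> g * \<rho> h)"

definition char_of :: "('a, 'b) monoid_scheme \<Rightarrow> nat \<Rightarrow> ('a \<Rightarrow> complex mat) \<Rightarrow> 'a \<Rightarrow> complex" where
  "char_of G d \<rho> = (\<lambda>g. if g \<in> carrier G then (\<Sum>i<d. \<rho> g $$ (i,i)) else 0)"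

definition invariant_subspace :: "('a, 'b) monoid_scheme \<Rightarrow> nat \<Rightarrow> ('a \<Rightarrow> complex mat) \<Rightarrow> complex vec set \<Rightarrow> bool" where
  "invariant_subspace G d \<rho> W \<longleftrightarrow>
     W \<subseteq> carrier_vec d \<and> 0\<^sub>v d \<in> W \<and>
     (\<forall>v\<in>W. \<forall>w\<in>W. v + w \<in> W) \<and>
     (\<forall>c. \<forall>v\<in>W. c \<cdot>\<^sub>v v \<in> W) \<and>
     (\<forall>g\<in>carrier G. \<forall>v\<in>W. \<rho> g *\<^sub>v v \<in> W)"

definition irreducible_rep :: "('a, 'b) monoid_scheme \<Rightarrow> nat \<Rightarrow> ('a \<Rightarrow> complex mat) \<Rightarrow> bool" where
  "irreducible_rep G d \<rho> \<longleftrightarrow> is_rep G d \<rho> \<and> d \<ge> 1 \<and>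
     (\<forall>W. invariant_subspace G d \<rho> W \<longrightarrow> W = {0\<^sub>v d} \<or> W = carrier_vec d)"

definition is_character :: "('a, 'b) monoid_scheme \<Rightarrow> ('a \<Rightarrow> complex) \<Rightarrow> bool" where
  "is_character G \<chi> \<longleftrightarrow> (\<exists>d \<rho>. d \<ge> 1 \<and> is_rep G d \<rho> \<and> \<chi> = char_of G d \<rho>)"

definition Irr :: "('a, 'b) monoid_scheme \<Rightarrow> ('a \<Rightarrow> complex) set" where
  "Irr G = {\<chi>. \<exists>d \<rho>. irreducible_rep G d \<rho> \<and> \<chi> = char_of G d \<rho>}"

definition Reg :: "('a, 'b) monoid_scheme \<Rightarrow> 'a \<Rightarrow> complex" where
  "Reg G = (\<lambda>g. \<Sum>\<chi>\<in>Irr G. \<chi> \<one>\<^bsub>G\<^esub> * \<chi> g)"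

definition Ind :: "('a, 'b) monoid_scheme \<Rightarrow> 'a set \<Rightarrow> ('a \<Rightarrow> complex) \<Rightarrow> 'a \<Rightarrow> complex" where
  "Ind G H \<phi> = (\<lambda>g. if g \<in> carrier G then
      (1 / of_nat (card H)) *
        (\<Sum>x\<in>{x \<in> carrier G. x \<otimes>\<^bsub>G\<^esub> g \<otimes>\<^bsub>G\<^esub> inv\<^bsub>G\<^esub> x \<in> H}. \<phi> (x \<otimes>\<^bsub>G\<^esub> g \<otimes>\<^bsub>G\<^esub> inv\<^bsub>G\<^esub> x))
      else 0)"

definition cyclic_subgroup :: "('a, 'b) monoid_scheme \<Rightarrow> 'a set \<Rightarrow> bool" where
  "cyclic_subgroup G H \<longleftrightarrow> (\<exists>g\<in>carrier G. H = generate G {g})"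

end

theory Submission
  imports Defs "Jordan_Normal_Form.Spectral_Radius" "HOL-Algebra.Multiplicative_Group"
begin

text \<open>
  Put \<open>\<Theta> = (\<Sum>\<chi>\<in>Irr G. n(G,\<chi>) \<chi>)\<close>, the Heilbronn character. By orthonormality of the irreducible
  characters, the left-hand side is the mean of \<open>|\<Theta>|\<^sup>2\<close> over \<open>G\<close>, and by additivity
  \<open>n(G, Reg) = \<Theta>(1)\<close>, so it suffices that \<open>|\<Theta>(g)| \<le> \<Theta>(1)\<close> for every \<open>g\<close>. Let \<open>H\<close> be the
  cyclic group generated by \<open>g\<close>. Frobenius reciprocity and invariance under induction show that the
  restriction of \<open>\<Theta>\<close> to \<open>H\<close> is the sum of \<open>n(H,\<theta>) \<theta>\<close> over the linear characters \<open>\<theta>\<close> of \<open>H\<close>; the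
  coefficients are nonnegative and \<open>|\<theta>(g)| = 1 = \<theta>(1)\<close>, so the triangle inequality gives the bound.

  Induction is only needed for linear characters of cyclic groups, and a character of \<open>G\<close> restricts
  to a sum of linear characters of \<open>H\<close> because a matrix of finite order can be triangularised.
\<close>

section \<open>Matrices of finite order\<close>

definition tr :: "complex mat \<Rightarrow> complex" where
  "tr A = (\<Sum>i<dim_row A. A $$ (i,i))"

lemma tr_mult_comm:
  assumes "A \<in> carrier_mat m k" "B \<in> carrier_mat k m"
  shows "tr (A * B) = tr (B * A)"
proof -
  have "tr (A * B) = (\<Sum>i<m. \<Sum>j<k. A $$ (i,j) * B $$ (j,i))"
    using assms unfolding tr_def by (auto simp: scalar_prod_def atLeast0LessThan intro!: sum.cong)
  also have "\<dots> = (\<Sum>j<k. \<Sum>i<m. B $$ (j,i) * A $$ (i,j))"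
    by (subst sum.swap) (simp add: mult.commute)
  also have "\<dots> = tr (B * A)"
    using assms unfolding tr_def by (auto simp: scalar_prod_def atLeast0LessThan intro!: sum.cong)
  finally show ?thesis .
qed

lemma tr_similar:
  assumes "similar_mat_wit A B P Q"
  shows "tr A = tr B"
proof -
  define n where "n = dim_row A"
  note d = similar_mat_witD[OF n_def assms]
  have "tr A = tr (P * (B * Q))"
    using d by (simp add: assoc_mult_mat[of P n n B n Q n])
  also have "\<dots> = tr ((B * Q) * P)"
    using d by (intro tr_mult_comm[of _ n n]) auto
  also have "(B * Q) * P = B"
    using d by (simp add: assoc_mult_mat[of B n n Q n P n])
  finally show ?thesis .
qed

lemma upper_triangular_mult:
  fixes A B :: "'a :: semiring_0 mat"
  assumes A: "A \<in> carrier_mat n n" "upper_triangular A"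
    and B: "B \<in> carrier_mat n n" "upper_triangular B"
  shows "upper_triangular (A * B)"
    and "i < n \<Longrightarrow> (A * B) $$ (i,i) = A $$ (i,i) * B $$ (i,i)"
proof -
  have e: "(A * B) $$ (i,j) = (\<Sum>k<n. A $$ (i,k) * B $$ (k,j))" if "i < n" "j < n" for i j
    using that A B by (auto simp: scalar_prod_def atLeast0LessThan)
  \<comment> \<open>A term can survive only for i \<le> k \<le> j: below the diagonal no k
    qualifies, on the diagonal only k = i does.\<close>
  have z: "A $$ (i,k) * B $$ (k,j) = 0" if "i < n" "k < n" "k < i \<or> j < k" for i j k
    using that upper_triangularD[OF A(2), of k i] upper_triangularD[OF B(2), of j k] A(1) B(1) by auto
  show "upper_triangular (A * B)"
  proof (rule upper_triangularI)
    fix i j assume ij: "j < i" "i < dim_row (A * B)"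
    then have "k < i \<or> j < k" for k by linarith
    then show "(A * B) $$ (i,j) = 0"
      using ij A(1) e[of i j] z by (auto intro!: sum.neutral)
  qed
  show "(A * B) $$ (i,i) = A $$ (i,i) * B $$ (i,i)" if i: "i < n"
  proof -
    have "(\<Sum>k<n. A $$ (i,k) * B $$ (k,i)) = (\<Sum>k\<in>{i}. A $$ (i,k) * B $$ (k,i))"
      using i z[of i _ i] by (intro sum.mono_neutral_right) (auto simp: neq_iff)
    then show ?thesis using e i by simp
  qed
qed

lemma upper_triangular_pow:
  fixes A :: "'a :: comm_ring_1 mat"
  assumes A: "A \<in> carrier_mat n n" "upper_triangular A"
  shows "upper_triangular (A ^\<^sub>m k) \<and> (\<forall>i<n. (A ^\<^sub>m k) $$ (i,i) = (A $$ (i,i)) ^ k)"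
proof (induction k)
  case 0
  then show ?case using A by auto
next
  case (Suc k)
  have c: "A ^\<^sub>m k \<in> carrier_mat n n" using A by simp
  show ?case using Suc upper_triangular_mult[OF c _ A] by (auto simp: mult.commute)
qed

lemma root_of_unity_norm:
  fixes e :: complex
  assumes "e ^ N = 1" "N > 0"
  shows "cmod e = 1"
  using power_eq_1_iff[OF assms(1)] assms(2) by simp

text \<open>Turns conjugation into a power, to be matched with
  \<open>inv g = g [^] (ord g - 1)\<close>.\<close>

lemma root_of_unity_cnj:
  fixes e :: complex
  assumes "e ^ N = 1" "N > 0"
  shows "cnj e = e ^ (N - 1)"
proof -
  have "cmod e = 1" by (rule root_of_unity_norm[OF assms])
  then have "e * cnj e = 1" by (simp add: complex_norm_square[symmetric])
  moreover have "e * e ^ (N - 1) = 1" using assms by (metis power_minus_mult mult.commute)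
  moreover have "e \<noteq> 0" using assms by (auto simp: zero_power)
  ultimately show ?thesis by (metis mult_left_cancel)
qed

text \<open>Schur triangularisation makes A similar to an upper triangular B. The diagonal of a
  power of B consists of the powers of the diagonal entries, and the trace is invariant under
  similarity, so the same entries serve for all k; \<open>B ^\<^sub>m N = 1\<^sub>m d\<close> makes
  them roots of unity.\<close>

lemma finite_order_mat_eigenvalues:
  fixes A :: "complex mat"
  assumes A: "A \<in> carrier_mat d d" and N: "A ^\<^sub>m N = 1\<^sub>m d"
  shows "\<exists>e. (\<forall>i<d. e i ^ N = 1) \<and> (\<forall>k. tr (A ^\<^sub>m k) = (\<Sum>i<d. e i ^ k))"
proof -
  obtain es where es: "char_poly A = (\<Prod>a\<leftarrow>es. [:- a, 1:])"
    using char_poly_factorized[OF A] by blast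
  obtain B where B: "B \<in> carrier_mat d d" "upper_triangular B" "similar_mat A B"
    using schur_decomposition_exists[OF A es] by blast
  then obtain P Q where sim: "similar_mat_wit A B P Q" unfolding similar_mat_def by blast
  note up = upper_triangular_pow[OF B(1,2)]
  have "tr (A ^\<^sub>m k) = (\<Sum>i<d. (B $$ (i,i)) ^ k)" for k
    using tr_similar[OF similar_mat_wit_pow[OF sim, of k]] up[of k] B(1)
    by (simp add: tr_def)
  moreover have "B ^\<^sub>m N = 1\<^sub>m d"
  proof -
    note d = similar_mat_witD2[OF A sim]
    have "B ^\<^sub>m N = Q * 1\<^sub>m d * P"
      using similar_mat_wit_pow_id[OF similar_mat_wit_sym[OF sim], of N] N by simp
    then show ?thesis using d by simp
  qed
  then have "\<forall>i<d. (B $$ (i,i)) ^ N = 1" using up[of N] by auto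
  ultimately show ?thesis by (intro exI[of _ "\<lambda>i. B $$ (i,i)"]) auto
qed

section \<open>Representations\<close>

lemma is_repD:
  assumes "is_rep G d \<rho>"
  shows "g \<in> carrier G \<Longrightarrow> \<rho> g \<in> carrier_mat d d"
    and "\<rho> \<one>\<^bsub>G\<^esub> = 1\<^sub>m d"
    and "g \<in> carrier G \<Longrightarrow> h \<in> carrier G \<Longrightarrow> \<rho> (g \<otimes>\<^bsub>G\<^esub> h) = \<rho> g * \<rho> h"
  using assms unfolding is_rep_def by auto

lemma char_of_eq_tr:
  assumes "is_rep G d \<rho>" "g \<in> carrier G"
  shows "char_of G d \<rho> g = tr (\<rho> g)"
  using is_repD(1)[OF assms] assms(2) by (auto simp: char_of_def tr_def)

lemma char_of_outside: "g \<notin> carrier G \<Longrightarrow> char_of G d \<rho> g = 0"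
  by (simp add: char_of_def)

context group
begin

lemma rep_pow:
  assumes "is_rep G d \<rho>" "g \<in> carrier G"
  shows "\<rho> (g [^] (k::nat)) = \<rho> g ^\<^sub>m k"
proof (induction k)
  case 0
  then show ?case using is_repD(1)[OF assms] is_repD(2)[OF assms(1)] by simp
next
  case (Suc k)
  then show ?case using is_repD(3)[OF assms(1) _ assms(2)] assms by simp
qed

text \<open>The \<open>e i\<close> are the eigenvalues of \<open>\<rho> g\<close> with multiplicity.
  For g of finite order each gives a linear character \<open>g [^] k \<mapsto> e i ^ k\<close>, so
  this splits the restriction to the cyclic group generated by g.\<close>

lemma char_of_powers:
  assumes "is_rep G d \<rho>" "g \<in> carrier G"
  shows "\<exists>e. (\<forall>i<d. e i ^ ord g = 1) \<and> (\<forall>k. char_of G d \<rho> (g [^] (k::nat)) = (\<Sum>i<d. e i ^ k))"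
proof -
  have "\<rho> g ^\<^sub>m ord g = 1\<^sub>m d"
    using rep_pow[OF assms, of "ord g"] assms is_repD(2)[OF assms(1)] by simp
  from finite_order_mat_eigenvalues[OF is_repD(1)[OF assms] this]
  show ?thesis using assms by (simp add: char_of_eq_tr rep_pow)
qed

lemma char_of_one:
  assumes "is_rep G d \<rho>"
  shows "char_of G d \<rho> \<one> = of_nat d"
  using assms by (simp add: char_of_eq_tr is_repD(2) tr_def)

lemma inv_eq_pow_ord:
  assumes "finite (carrier G)" "g \<in> carrier G"
  shows "inv g = g [^] (ord g - 1)"
proof (rule inv_equality)
  show "g [^] (ord g - 1) \<otimes> g = \<one>"
    using ord_ge_1[OF assms] pow_ord_eq_1[OF assms(2)]
    by (metis Suc_diff_1 Suc_le_eq nat_pow_Suc One_nat_def)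
qed (use assms in auto)

text \<open>The eigenvalues of \<open>\<rho> g\<close> are roots of unity, which conjugation
  inverts. This turns the orthogonality relations, first proved with \<open>inv g\<close>, into
  Hermitian ones.\<close>

lemma char_of_inv:
  assumes "finite (carrier G)" "is_rep G d \<rho>" "g \<in> carrier G"
  shows "char_of G d \<rho> (inv g) = cnj (char_of G d \<rho> g)"
proof -
  obtain e where e: "\<forall>i<d. e i ^ ord g = 1" "\<And>k. char_of G d \<rho> (g [^] (k::nat)) = (\<Sum>i<d. e i ^ k)"
    using char_of_powers[OF assms(2,3)] by blast
  have "char_of G d \<rho> g = (\<Sum>i<d. e i)" using e(2)[of 1] assms by simp
  moreover have "char_of G d \<rho> (inv g) = (\<Sum>i<d. e i ^ (ord g - 1))"
    using e(2) inv_eq_pow_ord[OF assms(1,3)] by simp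
  ultimately show ?thesis
    using e(1) root_of_unity_cnj ord_ge_1[OF assms(1,3)] by (auto intro!: sum.cong)
qed

lemma char_of_conj:
  assumes "is_rep G d \<rho>" "g \<in> carrier G" "y \<in> carrier G"
  shows "char_of G d \<rho> (y \<otimes> g \<otimes> inv y) = char_of G d \<rho> g"
proof -
  note c = is_repD(1)[OF assms(1)] and m = is_repD(3)[OF assms(1)]
  have "char_of G d \<rho> (y \<otimes> g \<otimes> inv y) = tr (\<rho> (y \<otimes> g) * \<rho> (inv y))"
    using assms by (simp add: char_of_eq_tr m)
  also have "\<dots> = tr (\<rho> (inv y) * \<rho> (y \<otimes> g))"
    using assms by (intro tr_mult_comm[of _ d d] c) auto
  also have "\<dots> = tr (\<rho> (inv y \<otimes> (y \<otimes> g)))" using assms by (simp add: m)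
  also have "inv y \<otimes> (y \<otimes> g) = g" using assms by (simp add: m_assoc[symmetric])
  finally show ?thesis using assms by (simp add: char_of_eq_tr)
qed

end

section \<open>Schur's lemma and orthogonality\<close>

text \<open>T is a linear map from the space of \<sigma>, of dimension e, to the space of \<rho>, of
  dimension d; hence its d rows and e columns.\<close>

definition intertwiner ::
  "('a, 'b) monoid_scheme \<Rightarrow> nat \<Rightarrow> ('a \<Rightarrow> complex mat) \<Rightarrow> nat \<Rightarrow> ('a \<Rightarrow> complex mat) \<Rightarrow> complex mat \<Rightarrow> bool"
  where "intertwiner G d \<rho> e \<sigma> T \<longleftrightarrow>
    T \<in> carrier_mat d e \<and> (\<forall>g\<in>carrier G. \<rho> g * T = T * \<sigma> g)"

lemma irreducible_repD:
  assumes "irreducible_rep G d \<rho>"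
  shows "is_rep G d \<rho>" "d \<ge> 1"
    "invariant_subspace G d \<rho> W \<Longrightarrow> W = {0\<^sub>v d} \<or> W = carrier_vec d"
  using assms unfolding irreducible_rep_def by auto

lemma mat_eq_zeroI:
  fixes T :: "'a :: comm_ring_1 mat"
  assumes T: "T \<in> carrier_mat d e" and z: "\<And>v. v \<in> carrier_vec e \<Longrightarrow> T *\<^sub>v v = 0\<^sub>v d"
  shows "T = 0\<^sub>m d e"
proof (rule eq_matI)
  fix i j assume ij: "i < dim_row (0\<^sub>m d e :: 'a mat)" "j < dim_col (0\<^sub>m d e :: 'a mat)"
  then have "(T *\<^sub>v unit_vec e j) $ i = 0" using z[of "unit_vec e j"] by simp
  then show "T $$ (i,j) = 0\<^sub>m d e $$ (i,j)" using ij T by (simp add: scalar_prod_right_unit)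
qed (use T in auto)

lemma kernel_invariant:
  assumes "is_rep G e \<sigma>" "is_rep G d \<rho>" "intertwiner G d \<rho> e \<sigma> T"
  shows "invariant_subspace G e \<sigma> {v \<in> carrier_vec e. T *\<^sub>v v = 0\<^sub>v d}"
proof -
  have T: "T \<in> carrier_mat d e" and c: "\<And>g. g \<in> carrier G \<Longrightarrow> \<rho> g * T = T * \<sigma> g"
    using assms(3) unfolding intertwiner_def by auto
  note s = is_repD(1)[OF assms(1)] and r = is_repD(1)[OF assms(2)]
  have "T *\<^sub>v (\<sigma> g *\<^sub>v v) = 0\<^sub>v d"
    if "g \<in> carrier G" "v \<in> carrier_vec e" "T *\<^sub>v v = 0\<^sub>v d" for g v
  proof -
    have "T *\<^sub>v (\<sigma> g *\<^sub>v v) = (\<rho> g * T) *\<^sub>v v"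
      using c[OF that(1)] assoc_mult_mat_vec[OF T s[OF that(1)] that(2)] by simp
    also have "\<dots> = \<rho> g *\<^sub>v 0\<^sub>v d"
      using assoc_mult_mat_vec[OF r[OF that(1)] T that(2)] that(3) by simp
    also have "\<dots> = 0\<^sub>v d" using r[OF that(1)] by auto
    finally show ?thesis .
  qed
  moreover have "\<sigma> g *\<^sub>v v \<in> carrier_vec e" if "g \<in> carrier G" "v \<in> carrier_vec e" for g v
    using s[OF that(1)] that(2) by simp
  moreover have "T *\<^sub>v 0\<^sub>v e = 0\<^sub>v d" using T by auto
  ultimately show ?thesis
    using T by (auto simp: invariant_subspace_def mult_add_distrib_mat_vec[OF T] mult_mat_vec[OF T])
qed

lemma image_invariant:
  assumes "is_rep G e \<sigma>" "is_rep G d \<rho>" "intertwiner G d \<rho> e \<sigma> T"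
  shows "invariant_subspace G d \<rho> {T *\<^sub>v v | v. v \<in> carrier_vec e}"
proof -
  have T: "T \<in> carrier_mat d e" and c: "\<And>g. g \<in> carrier G \<Longrightarrow> \<rho> g * T = T * \<sigma> g"
    using assms(3) unfolding intertwiner_def by auto
  note s = is_repD(1)[OF assms(1)] and r = is_repD(1)[OF assms(2)]
  let ?W = "{T *\<^sub>v v | v. v \<in> carrier_vec e}"
  have "T *\<^sub>v 0\<^sub>v e = 0\<^sub>v d" using T by auto
  then have "0\<^sub>v d \<in> ?W" by (metis (mono_tags, lifting) mem_Collect_eq zero_carrier_vec)
  moreover have "\<rho> g *\<^sub>v (T *\<^sub>v v) \<in> ?W" if "g \<in> carrier G" "v \<in> carrier_vec e" for g v
  proof -
    have "\<rho> g *\<^sub>v (T *\<^sub>v v) = T *\<^sub>v (\<sigma> g *\<^sub>v v)"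
      using c[OF that(1)] assoc_mult_mat_vec[OF T s[OF that(1)] that(2)]
        assoc_mult_mat_vec[OF r[OF that(1)] T that(2)] by simp
    moreover have "\<sigma> g *\<^sub>v v \<in> carrier_vec e" using s[OF that(1)] that(2) by simp
    ultimately show ?thesis by blast
  qed
  moreover have "T *\<^sub>v v + T *\<^sub>v w \<in> ?W" if "v \<in> carrier_vec e" "w \<in> carrier_vec e" for v w
    using that by (auto simp: mult_add_distrib_mat_vec[OF T, symmetric])
  moreover have "a \<cdot>\<^sub>v (T *\<^sub>v v) \<in> ?W" if "v \<in> carrier_vec e" for a v
    using that by (auto simp: mult_mat_vec[OF T, symmetric] intro!: exI[of _ "a \<cdot>\<^sub>v v"])
  ultimately show ?thesis
    using T by (auto simp: invariant_subspace_def)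
qed

text \<open>Irreducibility leaves only the zero kernel and the full image, so T is invertible and
  intertwining becomes similarity. As d = e is not known beforehand, a right inverse is built from
  surjectivity and injectivity shows that it is also a left inverse.\<close>

lemma schur_nonzero_intertwiner:
  assumes \<rho>: "irreducible_rep G d \<rho>" and \<sigma>: "irreducible_rep G e \<sigma>"
    and i: "intertwiner G d \<rho> e \<sigma> T" and nz: "T \<noteq> 0\<^sub>m d e"
  shows "char_of G d \<rho> = char_of G e \<sigma>"
proof -
  have T: "T \<in> carrier_mat d e" and c: "\<And>g. g \<in> carrier G \<Longrightarrow> \<rho> g * T = T * \<sigma> g"
    using i unfolding intertwiner_def by auto
  note rr = irreducible_repD(1)[OF \<rho>] and rs = irreducible_repD(1)[OF \<sigma>]
  obtain v where v: "v \<in> carrier_vec e" "T *\<^sub>v v \<noteq> 0\<^sub>v d" using mat_eq_zeroI[OF T] nz by blast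
  have ker: "{v \<in> carrier_vec e. T *\<^sub>v v = 0\<^sub>v d} = {0\<^sub>v e}"
    using irreducible_repD(3)[OF \<sigma> kernel_invariant[OF rs rr i]] v by blast
  have im: "{T *\<^sub>v v | v. v \<in> carrier_vec e} = carrier_vec d"
    using irreducible_repD(3)[OF \<rho> image_invariant[OF rs rr i]] v by blast
  \<comment> \<open>Preimages of the unit vectors under T, to become the columns of the right
    inverse B.\<close>
  have "\<exists>b. \<forall>j<d. b j \<in> carrier_vec e \<and> T *\<^sub>v b j = unit_vec d j"
  proof (intro choice allI)
    fix j
    have "unit_vec d j \<in> {T *\<^sub>v v | v. v \<in> carrier_vec e}" unfolding im by simp
    then show "\<exists>b. j < d \<longrightarrow> b \<in> carrier_vec e \<and> T *\<^sub>v b = unit_vec d j" by auto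
  qed
  then obtain b where b: "\<And>j. j < d \<Longrightarrow> b j \<in> carrier_vec e" "\<And>j. j < d \<Longrightarrow> T *\<^sub>v b j = unit_vec d j"
    by blast
  define B where "B = mat e d (\<lambda>(i,j). b j $ i)"
  have B: "B \<in> carrier_mat e d" by (simp add: B_def)
  have "col B j = b j" if "j < d" for j
    using b(1)[OF that] that by (intro eq_vecI) (auto simp: B_def)
  then have TB: "T * B = 1\<^sub>m d"
    using b(2) T B by (intro mat_col_eqI) (auto simp: col_mult2[OF T B])
  have "B * T = 1\<^sub>m e"
  proof -
    have D: "1\<^sub>m e - B * T \<in> carrier_mat e e" using B T by (intro minus_carrier_mat) auto
    \<comment> \<open>So the image of \<open>1 - B * T\<close> lies in the kernel of T, which is
      zero.\<close>
    have TD: "T * (1\<^sub>m e - B * T) = 0\<^sub>m d e"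
    proof -
      have "T * (1\<^sub>m e - B * T) = T * 1\<^sub>m e - T * (B * T)"
        using T B by (intro mult_minus_distrib_mat[of _ d e _ e]) auto
      also have "T * (B * T) = T" using T B TB by (simp add: assoc_mult_mat[OF T B T, symmetric])
      finally show ?thesis using T by simp
    qed
    have "(1\<^sub>m e - B * T) = 0\<^sub>m e e"
    proof (rule mat_eq_zeroI[OF D])
      fix v :: "complex vec" assume v: "v \<in> carrier_vec e"
      have "T *\<^sub>v ((1\<^sub>m e - B * T) *\<^sub>v v) = 0\<^sub>m d e *\<^sub>v v"
        using TD assoc_mult_mat_vec[OF T D v] by simp
      also have "\<dots> = 0\<^sub>v d" using v by auto
      finally have "(1\<^sub>m e - B * T) *\<^sub>v v \<in> {v \<in> carrier_vec e. T *\<^sub>v v = 0\<^sub>v d}"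
        using D v by auto
      then show "(1\<^sub>m e - B * T) *\<^sub>v v = 0\<^sub>v e" unfolding ker by simp
    qed
    then have z: "\<And>i j. i < e \<Longrightarrow> j < e \<Longrightarrow> (1\<^sub>m e - B * T) $$ (i,j) = 0" by simp
    show ?thesis
    proof (rule eq_matI)
      fix i j assume "i < dim_row (1\<^sub>m e :: complex mat)" "j < dim_col (1\<^sub>m e :: complex mat)"
      then show "(B * T) $$ (i,j) = 1\<^sub>m e $$ (i,j)"
        using z[of i j] B T by (simp del: index_mult_mat(1) index_one_mat(1))
    qed (use B T in auto)
  qed
  then have "tr (\<rho> g) = tr (\<sigma> g)" if g: "g \<in> carrier G" for g
  proof -
    note rg = is_repD(1)[OF rr g] and sg = is_repD(1)[OF rs g]
    \<comment> \<open>Insert \<open>T * B = 1\<close>, move T past the representation, then rotate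
      under the trace.\<close>
    have "tr (\<rho> g) = tr ((\<rho> g * T) * B)" using rg TB by (simp add: assoc_mult_mat[OF rg T B])
    also have "\<dots> = tr (T * (\<sigma> g * B))" by (simp add: c[OF g] assoc_mult_mat[OF T sg B])
    also have "\<dots> = tr ((\<sigma> g * B) * T)" using T sg B by (intro tr_mult_comm) auto
    also have "\<dots> = tr (\<sigma> g)" using \<open>B * T = 1\<^sub>m e\<close> sg by (simp add: assoc_mult_mat[OF sg B T])
    finally show ?thesis .
  qed
  then show ?thesis using rr rs by (intro ext) (metis char_of_eq_tr char_of_outside)
qed

text \<open>Subtracting an eigenvalue c from T gives an intertwiner with nonzero kernel; the kernel
  is invariant, so it is the whole space.\<close>

lemma schur_scalar:
  assumes \<rho>: "irreducible_rep G d \<rho>" and i: "intertwiner G d \<rho> d \<rho> T"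
  shows "\<exists>c. T = c \<cdot>\<^sub>m 1\<^sub>m d"
proof -
  note rr = irreducible_repD(1)[OF \<rho>]
  have T: "T \<in> carrier_mat d d" and cm: "\<And>g. g \<in> carrier G \<Longrightarrow> \<rho> g * T = T * \<rho> g"
    using i unfolding intertwiner_def by auto
  \<comment> \<open>The spectrum over the complex numbers is nonempty because d \<ge> 1.\<close>
  obtain c v where v: "v \<in> carrier_vec d" "v \<noteq> 0\<^sub>v d" "T *\<^sub>v v = c \<cdot>\<^sub>v v"
    using spectrum_non_empty[OF T] irreducible_repD(2)[OF \<rho>] T
    unfolding spectrum_def eigenvalue_def eigenvector_def by auto
  define S where "S = T - c \<cdot>\<^sub>m 1\<^sub>m d"
  have S: "S \<in> carrier_mat d d" using T by (auto simp: S_def)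
  have "intertwiner G d \<rho> d \<rho> S"
    unfolding intertwiner_def
  proof (intro conjI ballI S)
    fix g assume g: "g \<in> carrier G"
    note rg = is_repD(1)[OF rr g]
    have "\<rho> g * S = \<rho> g * T - \<rho> g * (c \<cdot>\<^sub>m 1\<^sub>m d)"
      unfolding S_def using rg T by (intro mult_minus_distrib_mat) auto
    also have "\<rho> g * (c \<cdot>\<^sub>m 1\<^sub>m d) = (c \<cdot>\<^sub>m 1\<^sub>m d) * \<rho> g"
      using rg by (simp add: mult_smult_distrib[OF rg, of _ d] mult_smult_assoc_mat[of _ d d _ d])
    also have "\<rho> g * T - (c \<cdot>\<^sub>m 1\<^sub>m d) * \<rho> g = S * \<rho> g"
      unfolding S_def cm[OF g] using rg T by (intro minus_mult_distrib_mat[symmetric]) auto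
    finally show "\<rho> g * S = S * \<rho> g" .
  qed
  from irreducible_repD(3)[OF \<rho> kernel_invariant[OF rr rr this]]
  have "{v \<in> carrier_vec d. S *\<^sub>v v = 0\<^sub>v d} = {0\<^sub>v d} \<or> {v \<in> carrier_vec d. S *\<^sub>v v = 0\<^sub>v d} = carrier_vec d" .
  moreover have "S *\<^sub>v v = 0\<^sub>v d"
    using v T unfolding S_def
    by (subst minus_mult_distrib_mat_vec[of _ d d]) auto
  ultimately have "\<And>w. w \<in> carrier_vec d \<Longrightarrow> S *\<^sub>v w = 0\<^sub>v d" using v by blast
  then have "S = 0\<^sub>m d d" by (rule mat_eq_zeroI[OF S])
  then have z: "\<And>i j. i < d \<Longrightarrow> j < d \<Longrightarrow> S $$ (i,j) = 0" by simp
  have "T = c \<cdot>\<^sub>m 1\<^sub>m d"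
  proof (rule eq_matI)
    fix i j assume "i < dim_row (c \<cdot>\<^sub>m 1\<^sub>m d)" "j < dim_col (c \<cdot>\<^sub>m 1\<^sub>m d)"
    then show "T $$ (i,j) = (c \<cdot>\<^sub>m 1\<^sub>m d) $$ (i,j)"
      using z[of i j] T unfolding S_def by (simp del: index_one_mat(1))
  qed (use T in auto)
  then show ?thesis by blast
qed

text \<open>Entrywise form of the sum over g of \<open>\<rho> g * E * \<sigma> (inv g)\<close>,
  where E is the d by e matrix unit with its 1 at (j,k). The sum is not divided by the group
  order.\<close>

definition elem_average ::
  "('a, 'b) monoid_scheme \<Rightarrow> nat \<Rightarrow> ('a \<Rightarrow> complex mat) \<Rightarrow> nat \<Rightarrow> ('a \<Rightarrow> complex mat) \<Rightarrow> nat \<Rightarrow> nat \<Rightarrow> complex mat"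
  where "elem_average G d \<rho> e \<sigma> j k =
    mat d e (\<lambda>(i,l). \<Sum>g\<in>carrier G. \<rho> g $$ (i,j) * \<sigma> (inv\<^bsub>G\<^esub> g) $$ (k,l))"

lemma mult_mat_entry:
  assumes "A \<in> carrier_mat m n" "B \<in> carrier_mat n p" "i < m" "j < p"
  shows "(A * B) $$ (i,j) = (\<Sum>a<n. A $$ (i,a) * B $$ (a,j))"
  using assms by (auto simp: scalar_prod_def atLeast0LessThan)

context group
begin

text \<open>Translating the summation variable by h turns a factor \<open>\<rho> h\<close> on the
  left into a factor \<open>\<sigma> h\<close> on the right.\<close>

lemma elem_average_intertwiner:
  assumes "is_rep G d \<rho>" "is_rep G e \<sigma>" "j < d" "k < e"
  shows "intertwiner G d \<rho> e \<sigma> (elem_average G d \<rho> e \<sigma> j k)"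
  unfolding intertwiner_def
proof (intro conjI ballI)
  let ?T = "elem_average G d \<rho> e \<sigma> j k"
  show T: "?T \<in> carrier_mat d e" by (simp add: elem_average_def)
  fix h assume h: "h \<in> carrier G"
  note r = is_repD(1)[OF assms(1)] and s = is_repD(1)[OF assms(2)]
  show "\<rho> h * ?T = ?T * \<sigma> h"
  proof (rule eq_matI)
    fix i l assume "i < dim_row (?T * \<sigma> h)" "l < dim_col (?T * \<sigma> h)"
    then have i: "i < d" and l: "l < e" using s[OF h] by (auto simp: elem_average_def)
    have "(\<rho> h * ?T) $$ (i,l) = (\<Sum>a<d. \<rho> h $$ (i,a) * ?T $$ (a,l))"
      using mult_mat_entry[OF r[OF h] T i l] .
    also have "\<dots> = (\<Sum>a<d. \<Sum>g\<in>carrier G. \<rho> h $$ (i,a) * \<rho> g $$ (a,j) * \<sigma> (inv g) $$ (k,l))"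
      using l by (auto simp: elem_average_def sum_distrib_left mult.assoc)
    also have "\<dots> = (\<Sum>g\<in>carrier G. (\<rho> h * \<rho> g) $$ (i,j) * \<sigma> (inv g) $$ (k,l))"
      using i assms(3) by (subst sum.swap) (auto simp: mult_mat_entry[OF r[OF h] r] sum_distrib_right intro!: sum.cong)
    also have "\<dots> = (\<Sum>g\<in>carrier G. \<rho> (h \<otimes> g) $$ (i,j) * \<sigma> (inv g) $$ (k,l))"
      using h by (simp add: is_repD(3)[OF assms(1)])
    \<comment> \<open>The new variable is \<open>h \<otimes> g\<close>; the inverse of the old one
      is the inverse of the new one times h.\<close>
    also have "\<dots> = (\<Sum>g\<in>carrier G. \<rho> g $$ (i,j) * \<sigma> (inv g \<otimes> h) $$ (k,l))"
      using h by (intro sum.reindex_bij_witness[of _ "\<lambda>g. inv h \<otimes> g" "\<lambda>g. h \<otimes> g"])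
        (auto simp: m_assoc[symmetric] inv_mult_group, simp add: m_assoc)
    also have "\<dots> = (\<Sum>g\<in>carrier G. \<Sum>a<e. \<rho> g $$ (i,j) * \<sigma> (inv g) $$ (k,a) * \<sigma> h $$ (a,l))"
      using h assms(4) l
      by (auto simp: is_repD(3)[OF assms(2)] mult_mat_entry[OF s s] sum_distrib_left mult.assoc intro!: sum.cong)
    also have "\<dots> = (\<Sum>a<e. ?T $$ (i,a) * \<sigma> h $$ (a,l))"
      using i by (subst sum.swap) (auto simp: elem_average_def sum_distrib_right)
    also have "\<dots> = (?T * \<sigma> h) $$ (i,l)"
      using mult_mat_entry[OF T s[OF h] i l] by simp
    finally show "(\<rho> h * ?T) $$ (i,l) = (?T * \<sigma> h) $$ (i,l)" .
  qed (use r[OF h] s[OF h] in \<open>auto simp: elem_average_def\<close>)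
qed

text \<open>Multiplying out the two traces gives products of diagonal entries, each of which sums
  over the group to one entry of one averaged matrix.\<close>

lemma char_of_mult_inv_sum:
  assumes "is_rep G d \<rho>" "is_rep G e \<sigma>"
  shows "(\<Sum>g\<in>carrier G. char_of G d \<rho> g * char_of G e \<sigma> (inv g)) =
    (\<Sum>i<d. \<Sum>k<e. elem_average G d \<rho> e \<sigma> i k $$ (i,k))"
proof -
  have "(\<Sum>g\<in>carrier G. char_of G d \<rho> g * char_of G e \<sigma> (inv g)) =
    (\<Sum>g\<in>carrier G. \<Sum>i<d. \<Sum>k<e. \<rho> g $$ (i,i) * \<sigma> (inv g) $$ (k,k))"
    by (auto simp: char_of_def sum_product intro!: sum.cong)
  also have "\<dots> = (\<Sum>i<d. \<Sum>k<e. \<Sum>g\<in>carrier G. \<rho> g $$ (i,i) * \<sigma> (inv g) $$ (k,k))"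
    by (subst sum.swap) (simp add: sum.swap[of _ _ "carrier G"])
  finally show ?thesis by (simp add: elem_average_def)
qed

text \<open>By Schur's lemma a nonzero averaged matrix would force equal characters, so all of them
  vanish.\<close>

lemma irreducible_char_orthogonal:
  assumes \<rho>: "irreducible_rep G d \<rho>" and \<sigma>: "irreducible_rep G e \<sigma>"
    and ne: "char_of G d \<rho> \<noteq> char_of G e \<sigma>"
  shows "(\<Sum>g\<in>carrier G. char_of G d \<rho> g * char_of G e \<sigma> (inv g)) = 0"
proof -
  note rr = irreducible_repD(1)[OF \<rho>] and rs = irreducible_repD(1)[OF \<sigma>]
  have "elem_average G d \<rho> e \<sigma> i k = 0\<^sub>m d e" if "i < d" "k < e" for i k
    using schur_nonzero_intertwiner[OF \<rho> \<sigma> elem_average_intertwiner[OF rr rs that]] ne by blast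
  then show ?thesis by (simp add: char_of_mult_inv_sum[OF rr rs])
qed

text \<open>Each averaged matrix is scalar, and its trace fixes the scalar. Only the d pairs with i
  = k contribute, each the group order divided by d.\<close>

lemma irreducible_char_norm:
  assumes \<rho>: "irreducible_rep G d \<rho>"
  shows "(\<Sum>g\<in>carrier G. char_of G d \<rho> g * char_of G d \<rho> (inv g)) = of_nat (card (carrier G))"
proof -
  note rr = irreducible_repD(1)[OF \<rho>] and d = irreducible_repD(2)[OF \<rho>]
  note r = is_repD(1)[OF rr]
  have *: "elem_average G d \<rho> d \<rho> i k $$ (i,k) = (if i = k then of_nat (card (carrier G)) / of_nat d else 0)"
    if ik: "i < d" "k < d" for i k
  proof -
    let ?T = "elem_average G d \<rho> d \<rho> i k"
    obtain c where c: "?T = c \<cdot>\<^sub>m 1\<^sub>m d"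
      using schur_scalar[OF \<rho> elem_average_intertwiner[OF rr rr ik]] by blast
    \<comment> \<open>Inside the trace \<open>\<rho> (inv g)\<close> meets \<open>\<rho> g\<close>,
      so every g contributes the (k,i) entry of the identity matrix.\<close>
    have "of_nat d * c = tr ?T" by (simp add: c tr_def)
    also have "\<dots> = (\<Sum>a<d. \<Sum>g\<in>carrier G. \<rho> (inv g) $$ (k,a) * \<rho> g $$ (a,i))"
      by (simp add: tr_def elem_average_def mult.commute)
    also have "\<dots> = (\<Sum>g\<in>carrier G. (\<rho> (inv g) * \<rho> g) $$ (k,i))"
      using ik by (subst sum.swap) (auto simp: mult_mat_entry[OF r r] intro!: sum.cong)
    also have "\<dots> = (\<Sum>g\<in>carrier G. if i = k then 1 else 0)"
      using ik by (intro sum.cong) (auto simp: is_repD(3)[OF rr, symmetric] is_repD(2)[OF rr])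
    finally have "c = (if i = k then of_nat (card (carrier G)) / of_nat d else 0)"
      using d by (auto simp: field_simps split: if_splits)
    then show ?thesis using ik by (simp add: c)
  qed
  have "(\<Sum>i<d. \<Sum>k<d. elem_average G d \<rho> d \<rho> i k $$ (i,k)) =
    (\<Sum>i<d. \<Sum>k<d. if i = k then of_nat (card (carrier G)) / of_nat d else 0)"
    using * by (intro sum.cong refl) auto
  also have "\<dots> = of_nat (card (carrier G))" using d by simp
  finally show ?thesis by (simp add: char_of_mult_inv_sum[OF rr rr])
qed

lemma Irr_orthonormal:
  assumes fin: "finite (carrier G)" and "\<chi> \<in> Irr G" "\<psi> \<in> Irr G"
  shows "(\<Sum>g\<in>carrier G. \<chi> g * cnj (\<psi> g)) = (if \<chi> = \<psi> then of_nat (card (carrier G)) else 0)"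
proof -
  obtain d \<rho> where \<rho>: "irreducible_rep G d \<rho>" "\<chi> = char_of G d \<rho>" using assms unfolding Irr_def by auto
  obtain e \<sigma> where \<sigma>: "irreducible_rep G e \<sigma>" "\<psi> = char_of G e \<sigma>" using assms unfolding Irr_def by auto
  have "(\<Sum>g\<in>carrier G. \<chi> g * cnj (\<psi> g)) = (\<Sum>g\<in>carrier G. \<chi> g * \<psi> (inv g))"
    using char_of_inv[OF fin irreducible_repD(1)[OF \<sigma>(1)]] \<sigma>(2) by simp
  then show ?thesis
    using irreducible_char_orthogonal[OF \<rho>(1) \<sigma>(1)] irreducible_char_norm[OF \<rho>(1)] \<rho>(2) \<sigma>(2) by auto
qed

end

section \<open>Decomposition into irreducible characters\<close>

definition lin_subspace :: "nat \<Rightarrow> complex vec set \<Rightarrow> bool" where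
  "lin_subspace d W \<longleftrightarrow> W \<subseteq> carrier_vec d \<and> 0\<^sub>v d \<in> W \<and>
     (\<forall>v\<in>W. \<forall>w\<in>W. v + w \<in> W) \<and> (\<forall>c. \<forall>v\<in>W. c \<cdot>\<^sub>v v \<in> W)"

lemma lin_subspace_mult_mat_vec:
  assumes W: "lin_subspace d W" and P: "P \<in> carrier_mat d m" and c: "c \<in> carrier_vec m"
    and col: "\<And>j. j < m \<Longrightarrow> col P j \<in> W"
  shows "P *\<^sub>v c \<in> W"
proof -
  \<comment> \<open>The product is a linear combination of the columns of P; the induction adds one
    column at a time.\<close>
  have "k \<le> m \<Longrightarrow> vec d (\<lambda>i. \<Sum>j<k. P $$ (i,j) * c $ j) \<in> W" for k
  proof (induction k)
    case 0
    have "vec d (\<lambda>i. \<Sum>j<0. P $$ (i,j) * c $ j) = 0\<^sub>v d" by (intro eq_vecI) auto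
    then show ?case using W unfolding lin_subspace_def by simp
  next
    case (Suc k)
    have "vec d (\<lambda>i. \<Sum>j<Suc k. P $$ (i,j) * c $ j) =
        vec d (\<lambda>i. \<Sum>j<k. P $$ (i,j) * c $ j) + c $ k \<cdot>\<^sub>v col P k"
      using P Suc.prems by (intro eq_vecI) (auto simp: mult.commute)
    then show ?case using W Suc col[of k] unfolding lin_subspace_def by auto
  qed
  from this[of m] have "vec d (\<lambda>i. \<Sum>j<m. P $$ (i,j) * c $ j) \<in> W" by simp
  also have "vec d (\<lambda>i. \<Sum>j<m. P $$ (i,j) * c $ j) = P *\<^sub>v c"
    using P c by (intro eq_vecI) (auto simp: scalar_prod_def atLeast0LessThan)
  finally show ?thesis .
qed

lemma obtain_inverse_mat:
  fixes P :: "'a :: field mat"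
  assumes P: "P \<in> carrier_mat d d" and det: "det P \<noteq> 0"
  obtains Q where "Q \<in> carrier_mat d d" "P * Q = 1\<^sub>m d" "Q * P = 1\<^sub>m d"
  using det_non_zero_imp_unit[OF P det, of "()"] unfolding Units_def ring_mat_def by auto

text \<open>Among the invertible matrices, one whose number of leading columns in \<open>W\<close> is largest works:
  a vector of \<open>W\<close> outside the span of these columns could be exchanged into the next column.\<close>

lemma adapted_basis:
  assumes W: "lin_subspace d W"
  obtains P Q r where "r \<le> d" "P \<in> carrier_mat d d" "Q \<in> carrier_mat d d" "P * Q = 1\<^sub>m d" "Q * P = 1\<^sub>m d"
    "\<And>j. j < r \<Longrightarrow> col P j \<in> W" "\<And>w j. w \<in> W \<Longrightarrow> r \<le> j \<Longrightarrow> j < d \<Longrightarrow> (Q *\<^sub>v w) $ j = 0"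
proof -
  define good where "good r P \<longleftrightarrow> r \<le> d \<and> P \<in> carrier_mat d d \<and> det P \<noteq> 0 \<and> (\<forall>j<r. col P j \<in> W)"
    for r and P :: "complex mat"
  have "good 0 (1\<^sub>m d)" by (simp add: good_def)
  then have ex: "\<exists>P. good 0 P" by blast
  \<comment> \<open>The maximum exists because \<open>good\<close> includes the bound r \<le>
    d.\<close>
  define r where "r = (GREATEST r. \<exists>P. good r P)"
  have bd: "\<And>k. \<exists>P. good k P \<Longrightarrow> k \<le> d" by (auto simp: good_def)
  obtain P where P: "good r P"
    using GreatestI_nat[of "\<lambda>r. \<exists>P. good r P", OF ex bd] unfolding r_def by blast
  have max: "\<And>k P. good k P \<Longrightarrow> k \<le> r"
    unfolding r_def using Greatest_le_nat[of "\<lambda>r. \<exists>P. good r P" _ d] bd by blast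
  have Pc: "P \<in> carrier_mat d d" and det: "det P \<noteq> 0" and rd: "r \<le> d"
    and cols: "\<And>j. j < r \<Longrightarrow> col P j \<in> W" using P by (auto simp: good_def)
  obtain Q where Q: "Q \<in> carrier_mat d d" "P * Q = 1\<^sub>m d" "Q * P = 1\<^sub>m d"
    using obtain_inverse_mat[OF Pc det] .
  have "(Q *\<^sub>v w) $ j = 0" if w: "w \<in> W" and j: "r \<le> j" "j < d" for w j
  proof (rule ccontr)
    assume nz: "(Q *\<^sub>v w) $ j \<noteq> 0"
    have wc: "w \<in> carrier_vec d" using W w unfolding lin_subspace_def by blast
    have Qw: "Q *\<^sub>v w \<in> carrier_vec d" using Q(1) wc by simp
    have PQw: "P *\<^sub>v (Q *\<^sub>v w) = w" using assoc_mult_mat_vec[OF Pc Q(1) wc] Q(2) wc by simp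
    define P1 where "P1 = replace_col P w j"
    have P1: "P1 \<in> carrier_mat d d" using Pc by (simp add: P1_def replace_col_def)
    \<comment> \<open>Cramer's rule for \<open>P *\<^sub>v (Q *\<^sub>v w) = w\<close>: putting w
      into column j scales the determinant by the nonzero coordinate j, so the matrix stays
      invertible.\<close>
    have "det P1 = (Q *\<^sub>v w) $ j * det P"
      using cramer_lemma_mat[OF Pc Qw j(2)] PQw by (simp add: P1_def)
    then have det1: "det P1 \<noteq> 0" using nz det by simp
    \<comment> \<open>Moves w into column r. Since r \<le> j, the first r columns stay in place, so
      r + 1 leading columns lie in W.\<close>
    define P2 where "P2 = swapcols r j P1"
    have P2: "P2 \<in> carrier_mat d d" using P1 by (simp add: P2_def)
    have "det P2 \<noteq> 0"
    proof (cases "r = j")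
      case True
      then have "P2 = P1" using P1 by (intro eq_matI) (auto simp: P2_def)
      then show ?thesis using det1 by simp
    next
      case False
      then show ?thesis using det1 j P1 by (simp add: P2_def det_swapcols[of r d j])
    qed
    moreover have "col P2 k \<in> W" if k: "k < Suc r" for k
    proof (cases "k = r")
      case True
      then have "col P2 k = w"
        using j Pc wc by (intro eq_vecI) (auto simp: P2_def P1_def replace_col_def)
      then show ?thesis using w by simp
    next
      case False
      then have "col P2 k = col P k"
        using k j Pc by (intro eq_vecI) (auto simp: P2_def P1_def replace_col_def)
      then show ?thesis using cols k False by simp
    qed
    ultimately have "good (Suc r) P2" using P2 j by (simp add: good_def)
    then show False using max by fastforce
  qed
  then show ?thesis using that[OF rd Pc Q(1,2,3) cols] by blast
qed

section \<open>Subspace and quotient of a reducible representation\<close>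

lemma sum_lessThan_split_at:
  "(\<Sum>a<r + (s::nat). f a) = (\<Sum>a<r. f a) + (\<Sum>a<s. f (a + r) :: 'a :: comm_monoid_add)"
  by (induction s) (auto simp: ac_simps)

text \<open>With a zero lower left block the diagonal blocks multiply separately:
  \<open>\<rho>1\<close> is the action on the span of the first r unit vectors,
  \<open>\<rho>2\<close> the action on the quotient.\<close>

lemma block_triangular_rep:
  assumes \<rho>: "is_rep G (r + s) \<rho>"
    and z: "\<And>g i j. g \<in> carrier G \<Longrightarrow> r \<le> i \<Longrightarrow> i < r + s \<Longrightarrow> j < r \<Longrightarrow> \<rho> g $$ (i,j) = 0"
  defines "\<rho>1 \<equiv> \<lambda>g. mat r r (\<lambda>(i,j). \<rho> g $$ (i,j))"
    and "\<rho>2 \<equiv> \<lambda>g. mat s s (\<lambda>(i,j). \<rho> g $$ (i + r,j + r))"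
  shows "is_rep G r \<rho>1" "is_rep G s \<rho>2"
    "char_of G (r + s) \<rho> = (\<lambda>g. char_of G r \<rho>1 g + char_of G s \<rho>2 g)"
proof -
  note c = is_repD(1)[OF \<rho>]
  have m: "\<rho> (g \<otimes>\<^bsub>G\<^esub> h) $$ (i,j) =
      (\<Sum>a<r. \<rho> g $$ (i,a) * \<rho> h $$ (a,j)) + (\<Sum>a<s. \<rho> g $$ (i,a + r) * \<rho> h $$ (a + r,j))"
    if "g \<in> carrier G" "h \<in> carrier G" "i < r + s" "j < r + s" for g h i j
    using mult_mat_entry[OF c[OF that(1)] c[OF that(2)] that(3,4)] is_repD(3)[OF \<rho> that(1,2)]
    by (simp add: sum_lessThan_split_at)
  show "is_rep G r \<rho>1"
    unfolding is_rep_def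
  proof (intro conjI ballI)
    show "\<rho>1 \<one>\<^bsub>G\<^esub> = 1\<^sub>m r" using is_repD(2)[OF \<rho>] by (intro eq_matI) (auto simp: \<rho>1_def)
    fix g h assume gh: "g \<in> carrier G" "h \<in> carrier G"
    show "\<rho>1 (g \<otimes>\<^bsub>G\<^esub> h) = \<rho>1 g * \<rho>1 h"
    proof (rule eq_matI)
      fix i j assume "i < dim_row (\<rho>1 g * \<rho>1 h)" "j < dim_col (\<rho>1 g * \<rho>1 h)"
      then show "\<rho>1 (g \<otimes>\<^bsub>G\<^esub> h) $$ (i,j) = (\<rho>1 g * \<rho>1 h) $$ (i,j)"
        using gh by (subst mult_mat_entry[of _ r r _ r]) (auto simp: \<rho>1_def m z)
    qed (auto simp: \<rho>1_def)
  qed (simp add: \<rho>1_def)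
  show "is_rep G s \<rho>2"
    unfolding is_rep_def
  proof (intro conjI ballI)
    show "\<rho>2 \<one>\<^bsub>G\<^esub> = 1\<^sub>m s" using is_repD(2)[OF \<rho>] by (intro eq_matI) (auto simp: \<rho>2_def)
    fix g h assume gh: "g \<in> carrier G" "h \<in> carrier G"
    show "\<rho>2 (g \<otimes>\<^bsub>G\<^esub> h) = \<rho>2 g * \<rho>2 h"
    proof (rule eq_matI)
      fix i j assume "i < dim_row (\<rho>2 g * \<rho>2 h)" "j < dim_col (\<rho>2 g * \<rho>2 h)"
      then show "\<rho>2 (g \<otimes>\<^bsub>G\<^esub> h) $$ (i,j) = (\<rho>2 g * \<rho>2 h) $$ (i,j)"
        using gh by (subst mult_mat_entry[of _ s s _ s]) (auto simp: \<rho>2_def m z)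
    qed (auto simp: \<rho>2_def)
  qed (simp add: \<rho>2_def)
  show "char_of G (r + s) \<rho> = (\<lambda>g. char_of G r \<rho>1 g + char_of G s \<rho>2 g)"
    by (auto simp: char_of_def \<rho>1_def \<rho>2_def sum_lessThan_split_at)
qed

lemma conjugate_rep:
  assumes \<rho>: "is_rep G d \<rho>" and P: "P \<in> carrier_mat d d" and Q: "Q \<in> carrier_mat d d"
    and PQ: "P * Q = 1\<^sub>m d" "Q * P = 1\<^sub>m d"
  defines "\<sigma> \<equiv> \<lambda>g. Q * \<rho> g * P"
  shows "is_rep G d \<sigma>" "char_of G d \<sigma> = char_of G d \<rho>"
proof -
  note c = is_repD(1)[OF \<rho>]
  show \<sigma>: "is_rep G d \<sigma>"
    unfolding is_rep_def
  proof (intro conjI ballI)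
    fix g assume g: "g \<in> carrier G"
    show "\<sigma> g \<in> carrier_mat d d" using c[OF g] P Q by (simp add: \<sigma>_def)
    fix h assume h: "h \<in> carrier G"
    have gh: "Q * \<rho> g \<in> carrier_mat d d" "\<rho> h * P \<in> carrier_mat d d" using c[OF g] c[OF h] P Q by auto
    have QhP: "Q * (\<rho> h * P) \<in> carrier_mat d d" using gh Q by simp
    have "\<sigma> g * \<sigma> h = (Q * \<rho> g) * (P * (Q * (\<rho> h * P)))"
      unfolding \<sigma>_def assoc_mult_mat[OF Q c[OF h] P] by (rule assoc_mult_mat[OF gh(1) P QhP])
    also have "\<dots> = (Q * \<rho> g) * (\<rho> h * P)"
      unfolding assoc_mult_mat[OF P Q gh(2), symmetric] PQ(1) left_mult_one_mat[OF gh(2)] ..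
    also have "\<dots> = Q * (\<rho> g * \<rho> h) * P"
      unfolding assoc_mult_mat[OF gh(1) c[OF h] P, symmetric] assoc_mult_mat[OF Q c[OF g] c[OF h]] ..
    also have "\<dots> = \<sigma> (g \<otimes>\<^bsub>G\<^esub> h)"
      by (simp add: \<sigma>_def is_repD(3)[OF \<rho> g h])
    finally show "\<sigma> (g \<otimes>\<^bsub>G\<^esub> h) = \<sigma> g * \<sigma> h" by simp
  qed (use PQ Q is_repD(2)[OF \<rho>] in \<open>simp add: \<sigma>_def\<close>)
  have "tr (\<sigma> g) = tr (\<rho> g)" if g: "g \<in> carrier G" for g
    using similar_mat_witI[OF PQ(2,1) _ _ c[OF g] Q P, of "\<sigma> g"] is_repD(1)[OF \<sigma> g] \<sigma>_def tr_similar
    by metis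
  then show "char_of G d \<sigma> = char_of G d \<rho>"
    using \<rho> \<sigma> by (intro ext) (metis char_of_eq_tr char_of_outside)
qed

context group
begin

text \<open>In a basis whose first r vectors span W, invariance of W makes all matrices block
  triangular with the same block sizes.\<close>

lemma char_of_reducible:
  assumes \<rho>: "is_rep G d \<rho>" and "invariant_subspace G d \<rho> W" "W \<noteq> {0\<^sub>v d}" "W \<noteq> carrier_vec d"
  shows "\<exists>r s \<rho>1 \<rho>2. 0 < r \<and> r < d \<and> 0 < s \<and> s < d \<and> is_rep G r \<rho>1 \<and> is_rep G s \<rho>2 \<and>
    char_of G d \<rho> = (\<lambda>g. char_of G r \<rho>1 g + char_of G s \<rho>2 g)"
proof -
  have W: "lin_subspace d W" and inv: "\<And>g v. g \<in> carrier G \<Longrightarrow> v \<in> W \<Longrightarrow> \<rho> g *\<^sub>v v \<in> W"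
    using assms(2) unfolding invariant_subspace_def lin_subspace_def by auto
  obtain P Q r where b: "r \<le> d" "P \<in> carrier_mat d d" "Q \<in> carrier_mat d d" "P * Q = 1\<^sub>m d" "Q * P = 1\<^sub>m d"
    "\<And>j. j < r \<Longrightarrow> col P j \<in> W" "\<And>w j. w \<in> W \<Longrightarrow> r \<le> j \<Longrightarrow> j < d \<Longrightarrow> (Q *\<^sub>v w) $ j = 0"
    using adapted_basis[OF W] by metis
  have PQw: "P *\<^sub>v (Q *\<^sub>v w) = w" if "w \<in> carrier_vec d" for w
    using assoc_mult_mat_vec[OF b(2,3) that] b(4) that by simp
  have Wc: "W \<subseteq> carrier_vec d" "0\<^sub>v d \<in> W" using W unfolding lin_subspace_def by auto
  \<comment> \<open>Otherwise all columns of the invertible P lie in W, and W is the whole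
    space.\<close>
  have "r \<noteq> d"
  proof
    assume "r = d"
    then have "P *\<^sub>v (Q *\<^sub>v w) \<in> W" if "w \<in> carrier_vec d" for w
      using that b(3) by (intro lin_subspace_mult_mat_vec[OF W b(2) _ b(6)]) auto
    then show False using PQw Wc assms(4) by force
  qed
  \<comment> \<open>Otherwise every vector of W has only zero coordinates in the new basis.\<close>
  have "r \<noteq> 0"
  proof
    assume r0: "r = 0"
    have "w = 0\<^sub>v d" if w: "w \<in> W" for w
    proof -
      have "Q *\<^sub>v w = 0\<^sub>v d" using b(3) b(7)[OF w] r0 by (intro eq_vecI) auto
      moreover have "P *\<^sub>v 0\<^sub>v d = 0\<^sub>v d" using b(2) by auto
      ultimately show ?thesis using PQw[of w] w Wc by auto
    qed
    then show False using assms(3) Wc by blast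
  qed
  define s where "s = d - r"
  have d: "d = r + s" using b(1) by (simp add: s_def)
  let ?\<sigma> = "\<lambda>g. Q * \<rho> g * P"
  note cr = conjugate_rep[OF \<rho> b(2-5)]
  \<comment> \<open>Column j holds the new coordinates of \<open>\<rho> g *\<^sub>v col P j\<close>.
    This vector lies in W, so its coordinates from r on vanish.\<close>
  have z: "?\<sigma> g $$ (i,j) = 0" if g: "g \<in> carrier G" and i: "r \<le> i" "i < r + s" and j: "j < r" for g i j
  proof -
    note rg = is_repD(1)[OF \<rho> g]
    have "?\<sigma> g $$ (i,j) = (Q * (\<rho> g * P)) $$ (i,j)" using assoc_mult_mat[OF b(3) rg b(2)] by simp
    also have "\<dots> = col (Q * (\<rho> g * P)) j $ i" using i j d b(2,3) rg by simp
    also have "col (Q * (\<rho> g * P)) j = Q *\<^sub>v (\<rho> g *\<^sub>v col P j)"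
    proof -
      have "\<rho> g * P \<in> carrier_mat d d" using rg b(2) by simp
      then show ?thesis using j d by (simp add: col_mult2[OF b(3)] col_mult2[OF rg b(2)])
    qed
    also have "\<dots> $ i = 0" using b(7)[OF inv[OF g b(6)[OF j]]] i d by simp
    finally show ?thesis .
  qed
  have "0 < r" "r < d" "0 < s" "s < d" using \<open>r \<noteq> d\<close> \<open>r \<noteq> 0\<close> d by auto
  moreover note B = block_triangular_rep[OF cr(1)[unfolded d] z]
  moreover note trans[OF cr(2)[symmetric, unfolded d] B(3), folded d]
  ultimately show ?thesis
    by - (rule exI[of _ r], rule exI[of _ s], rule exI, rule exI, intro conjI)
qed

text \<open>Complete reducibility is not needed: traces only see the composition factors.\<close>

lemma char_of_sum_Irr:
  assumes "is_rep G d \<rho>" "d \<ge> 1"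
  shows "\<exists>xs. xs \<noteq> [] \<and> set xs \<subseteq> Irr G \<and> char_of G d \<rho> = (\<lambda>g. \<Sum>\<chi>\<leftarrow>xs. \<chi> g)"
  using assms
proof (induction d arbitrary: \<rho> rule: less_induct)
  case (less d)
  show ?case
  proof (cases "irreducible_rep G d \<rho>")
    case True
    then show ?thesis by (intro exI[of _ "[char_of G d \<rho>]"]) (auto simp: Irr_def)
  next
    case False
    then obtain W where "invariant_subspace G d \<rho> W" "W \<noteq> {0\<^sub>v d}" "W \<noteq> carrier_vec d"
      using less.prems unfolding irreducible_rep_def by blast
    from char_of_reducible[OF less.prems(1) this] obtain r s \<rho>1 \<rho>2 where
      rs: "0 < r" "r < d" "0 < s" "s < d" "is_rep G r \<rho>1" "is_rep G s \<rho>2"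
      and e: "char_of G d \<rho> = (\<lambda>g. char_of G r \<rho>1 g + char_of G s \<rho>2 g)" by blast
    obtain xs where xs: "xs \<noteq> []" "set xs \<subseteq> Irr G" "char_of G r \<rho>1 = (\<lambda>g. \<Sum>\<chi>\<leftarrow>xs. \<chi> g)"
      using less.IH[OF rs(2,5)] rs by auto
    obtain ys where ys: "ys \<noteq> []" "set ys \<subseteq> Irr G" "char_of G s \<rho>2 = (\<lambda>g. \<Sum>\<chi>\<leftarrow>ys. \<chi> g)"
      using less.IH[OF rs(4,6)] rs by auto
    show ?thesis using xs ys e by (intro exI[of _ "xs @ ys"]) auto
  qed
qed

end

text \<open>The block diagonal direct sum realises the sum. This keeps partial sums within the scope
  of additivity when it is iterated along a list.\<close>

lemma is_character_add:
  assumes "is_character G \<phi>1" "is_character G \<phi>2"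
  shows "is_character G (\<lambda>g. \<phi>1 g + \<phi>2 g)"
proof -
  obtain d \<rho> where \<rho>: "d \<ge> 1" "is_rep G d \<rho>" "\<phi>1 = char_of G d \<rho>" using assms(1) unfolding is_character_def by blast
  obtain e \<sigma> where \<sigma>: "e \<ge> 1" "is_rep G e \<sigma>" "\<phi>2 = char_of G e \<sigma>" using assms(2) unfolding is_character_def by blast
  define \<tau> where "\<tau> g = four_block_mat (\<rho> g) (0\<^sub>m d e) (0\<^sub>m e d) (\<sigma> g)" for g
  note r = is_repD(1)[OF \<rho>(2)] and s = is_repD(1)[OF \<sigma>(2)]
  have "is_rep G (d + e) \<tau>"
    unfolding is_rep_def
  proof (intro conjI ballI)
    show "\<tau> \<one>\<^bsub>G\<^esub> = 1\<^sub>m (d + e)"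
      using is_repD(2)[OF \<rho>(2)] is_repD(2)[OF \<sigma>(2)] by (simp add: \<tau>_def)
    fix g assume g: "g \<in> carrier G"
    show "\<tau> g \<in> carrier_mat (d + e) (d + e)" using r[OF g] s[OF g] by (simp add: \<tau>_def)
    fix h assume h: "h \<in> carrier G"
    show "\<tau> (g \<otimes>\<^bsub>G\<^esub> h) = \<tau> g * \<tau> h"
      unfolding \<tau>_def
      using r[OF g] s[OF g] r[OF h] s[OF h] is_repD(3)[OF \<rho>(2) g h] is_repD(3)[OF \<sigma>(2) g h]
      by (subst mult_four_block_mat[of _ d d _ e _ e _ _ d _ e]) auto
  qed
  moreover have "char_of G (d + e) \<tau> = (\<lambda>g. \<phi>1 g + \<phi>2 g)"
  proof
    fix g
    show "char_of G (d + e) \<tau> g = \<phi>1 g + \<phi>2 g"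
    proof (cases "g \<in> carrier G")
      case True
      then show ?thesis using r[of g] s[of g]
        by (auto simp: \<rho>(3) \<sigma>(3) char_of_def \<tau>_def sum_lessThan_split_at)
    qed (simp add: \<rho>(3) \<sigma>(3) char_of_def)
  qed
  ultimately show ?thesis using \<rho>(1) unfolding is_character_def by (intro exI[of _ "d + e"] exI[of _ \<tau>]) auto
qed

lemma Irr_is_character: "\<chi> \<in> Irr G \<Longrightarrow> is_character G \<chi>"
  unfolding Irr_def is_character_def irreducible_rep_def by blast

section \<open>Induction from cyclic subgroups\<close>

text \<open>The discrete logarithm \<open>k\<close> is determined only modulo the order of \<open>g\<close>, so this is a
  character of the cyclic group generated by \<open>g\<close> exactly when \<open>\<omega>\<close> is a root of unity of that order.\<close>

definition lin_char :: "('a, 'b) monoid_scheme \<Rightarrow> 'a \<Rightarrow> complex \<Rightarrow> 'a \<Rightarrow> complex" where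
  "lin_char G g \<omega> x = (if x \<in> generate G {g} then \<omega> ^ (SOME k::nat. x = g [^]\<^bsub>G\<^esub> k) else 0)"

context group
begin

text \<open>The exponents differ by a multiple of \<open>ord g\<close>. This makes the choice of
  discrete logarithm in \<open>lin_char\<close> immaterial.\<close>

lemma root_of_unity_pow_cong:
  fixes \<omega> :: complex and k l :: nat
  assumes "g \<in> carrier G" "\<omega> ^ ord g = 1" "g [^] k = g [^] l"
  shows "\<omega> ^ k = \<omega> ^ l"
proof -
  have *: "\<omega> ^ k = \<omega> ^ l" if "k \<le> l" "g [^] k = g [^] l" for k l :: nat
  proof -
    have "g [^] k \<otimes> g [^] (l - k) = g [^] k \<otimes> \<one>"
      using that assms(1) nat_pow_mult[OF assms(1), of k "l - k"] by simp
    then have "g [^] (l - k) = \<one>" using assms(1) by simp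
    then obtain m where "l - k = ord g * m" using assms(1) by (auto simp: pow_eq_id elim: dvdE)
    then have "\<omega> ^ (l - k) = 1" using assms(2) by (simp add: power_mult)
    then show ?thesis using that(1) by (metis le_add_diff_inverse mult.right_neutral power_add)
  qed
  show ?thesis using *[of k l] *[of l k] assms(3) by (metis nat_le_linear)
qed

context
  fixes g and \<omega> :: complex
  assumes fin: "finite (carrier G)" and g: "g \<in> carrier G" and \<omega>: "\<omega> ^ ord g = 1"
begin

lemma lin_char_pow: "lin_char G g \<omega> (g [^] (k::nat)) = \<omega> ^ k"
proof -
  have "g [^] k \<in> generate G {g}" using generate_pow_on_finite_carrier[OF fin g] by auto
  moreover have "g [^] k = g [^] (SOME l::nat. g [^] k = g [^] l)" by (rule someI) (rule refl)
  then have "\<omega> ^ k = \<omega> ^ (SOME l::nat. g [^] k = g [^] l)" by (rule root_of_unity_pow_cong[OF g \<omega>])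
  ultimately show ?thesis by (simp add: lin_char_def)
qed

lemma lin_char_mult:
  assumes "x \<in> generate G {g}" "y \<in> generate G {g}"
  shows "lin_char G g \<omega> (x \<otimes> y) = lin_char G g \<omega> x * lin_char G g \<omega> y"
proof -
  obtain k l :: nat where "x = g [^] k" "y = g [^] l"
    using assms generate_pow_on_finite_carrier[OF fin g] by auto
  then show ?thesis using g by (simp add: nat_pow_mult lin_char_pow power_add)
qed

lemma lin_char_one: "lin_char G g \<omega> \<one> = 1"
  using lin_char_pow[of 0] by simp

lemma is_character_lin_char: "is_character (G\<lparr>carrier := generate G {g}\<rparr>) (lin_char G g \<omega>)"
  unfolding is_character_def
proof (intro exI conjI)
  let ?\<rho> = "\<lambda>x. mat 1 1 (\<lambda>_. lin_char G g \<omega> x)"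
  show "(1::nat) \<le> 1" by simp
  show "is_rep (G\<lparr>carrier := generate G {g}\<rparr>) 1 ?\<rho>"
    by (auto simp: is_rep_def lin_char_one lin_char_mult scalar_prod_def intro!: eq_matI)
  show "lin_char G g \<omega> = char_of (G\<lparr>carrier := generate G {g}\<rparr>) 1 ?\<rho>"
    by (auto simp: char_of_def lin_char_def)
qed

end

section \<open>Coset representatives and the induced representation\<close>

lemma right_transversal:
  assumes fin: "finite (carrier G)" and H: "subgroup H G"
  obtains ts where "set ts \<subseteq> carrier G"
    "\<And>x. x \<in> carrier G \<Longrightarrow> \<exists>!i. i < length ts \<and> x \<otimes> inv (ts ! i) \<in> H"
proof -
  interpret H: subgroup H G by (rule H)
  \<comment> \<open>The choice depends on x only through its coset, so \<tau> is constant on cosets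
    and its image contains one representative of each.\<close>
  define \<tau> where "\<tau> x = (SOME y. y \<in> H #> x)" for x
  have \<tau>: "\<tau> x \<in> H #> x" if "x \<in> carrier G" for x
    unfolding \<tau>_def using rcos_self[OF that H] by (rule someI)
  have \<tau>c: "\<tau> x \<in> carrier G" if "x \<in> carrier G" for x
    using H.elemrcos_carrier[OF is_group that \<tau>[OF that]] .
  have iff: "x \<otimes> inv (\<tau> y) \<in> H \<longleftrightarrow> \<tau> y = \<tau> x" if x: "x \<in> carrier G" and y: "y \<in> carrier G" for x y
  proof
    assume "x \<otimes> inv (\<tau> y) \<in> H"
    then have "x \<in> H #> \<tau> y"
      using x \<tau>c[OF y] by (auto simp: r_coset_def m_assoc intro!: bexI[of _ "x \<otimes> inv (\<tau> y)"])
    then have "H #> \<tau> y = H #> x" by (rule repr_independence[OF _ \<tau>c[OF y] H])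
    with repr_independence[OF \<tau>[OF y] y H] have "H #> y = H #> x" by (rule trans)
    then show "\<tau> y = \<tau> x" by (simp only: \<tau>_def)
  next
    assume e: "\<tau> y = \<tau> x"
    obtain h where h: "h \<in> H" "\<tau> x = h \<otimes> x" using \<tau>[OF x] by (auto simp: r_coset_def)
    have "x \<otimes> inv (\<tau> x) = inv h"
      using h x by (simp add: inv_mult_group m_assoc[symmetric])
    then show "x \<otimes> inv (\<tau> y) \<in> H" using e h by simp
  qed
  obtain ts where ts: "set ts = \<tau> ` carrier G" "distinct ts"
    using finite_distinct_list[of "\<tau> ` carrier G"] fin by auto
  have "\<exists>!i. i < length ts \<and> x \<otimes> inv (ts ! i) \<in> H" if x: "x \<in> carrier G" for x
  proof -
    have "x \<otimes> inv (ts ! i) \<in> H \<longleftrightarrow> ts ! i = \<tau> x" if i: "i < length ts" for i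
    proof -
      obtain y where "y \<in> carrier G" "ts ! i = \<tau> y" using nth_mem[OF i] ts(1) by auto
      then show ?thesis using iff[OF x] by simp
    qed
    moreover have "\<exists>!i. i < length ts \<and> ts ! i = \<tau> x"
      using ts x by (intro distinct_Ex1) auto
    ultimately show ?thesis by metis
  qed
  moreover have "set ts \<subseteq> carrier G" using ts(1) \<tau>c by auto
  ultimately show ?thesis by (intro that)
qed

text \<open>Induction of a one-dimensional character is realised by the monomial matrices with entries
  \<open>\<theta> (t\<^sub>i g t\<^sub>j\<inverse>)\<close>, where the \<open>t\<^sub>i\<close> represent the right cosets and \<open>\<theta>\<close> is extended by zero.\<close>

lemma is_character_Ind_linear:
  fixes \<theta> :: "'a \<Rightarrow> complex"
  assumes fin: "finite (carrier G)" and H: "subgroup H G"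
    and out: "\<And>x. x \<notin> H \<Longrightarrow> \<theta> x = 0" and one: "\<theta> \<one> = 1"
    and mult: "\<And>x y. x \<in> H \<Longrightarrow> y \<in> H \<Longrightarrow> \<theta> (x \<otimes> y) = \<theta> x * \<theta> y"
  shows "is_character G (Ind G H \<theta>)"
proof -
  interpret H: subgroup H G by (rule H)
  have finH: "finite H" using fin H.subset finite_subset by blast
  obtain ts where ts: "set ts \<subseteq> carrier G"
    "\<And>x. x \<in> carrier G \<Longrightarrow> \<exists>!i. i < length ts \<and> x \<otimes> inv (ts ! i) \<in> H"
    using right_transversal[OF fin H] by blast
  define d where "d = length ts"
  define t where "t i = ts ! i" for i
  \<comment> \<open>The index of the right coset containing x: x is \<open>t (J x)\<close>
    multiplied on the left by an element of H.\<close>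
  define J where "J x = (THE i. i < d \<and> x \<otimes> inv (t i) \<in> H)" for x
  have t: "t i \<in> carrier G" if "i < d" for i using that ts(1) by (auto simp: t_def d_def)
  have J: "J x < d" "x \<otimes> inv (t (J x)) \<in> H" if "x \<in> carrier G" for x
    using theI'[OF ts(2)[OF that]] unfolding J_def t_def d_def by auto
  have Ju: "i = J x" if "x \<in> carrier G" "i < d" "x \<otimes> inv (t i) \<in> H" for x i
    using ts(2)[OF that(1)] J[OF that(1)] that unfolding t_def d_def by blast
  \<comment> \<open>Multiplicativity survives extension by zero as long as one factor is in H: for y
    outside H both sides vanish.\<close>
  have \<theta>l: "\<theta> (x \<otimes> y) = \<theta> x * \<theta> y" if x: "x \<in> H" and y: "y \<in> carrier G" for x y
  proof (cases "y \<in> H")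
    case False
    have "x \<otimes> y \<notin> H"
    proof
      assume "x \<otimes> y \<in> H"
      then have "inv x \<otimes> (x \<otimes> y) \<in> H" using x by blast
      then show False using False x y by (simp add: m_assoc[symmetric])
    qed
    then show ?thesis using False out by simp
  qed (use x mult in simp)
  \<comment> \<open>Conjugation by H preserves both H and its complement, and the values of \<theta>
    commute. This later makes the summand of \<open>Ind\<close> constant on right cosets.\<close>
  have \<theta>c: "\<theta> (h \<otimes> x \<otimes> inv h) = \<theta> x" if h: "h \<in> H" and x: "x \<in> carrier G" for h x
  proof (cases "x \<in> H")
    case True
    have "\<theta> h * \<theta> (inv h) = 1" using mult[of h "inv h"] h one by simp
    then show ?thesis using True h mult by simp
  next
    case False
    have "h \<otimes> x \<otimes> inv h \<notin> H"
    proof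
      assume "h \<otimes> x \<otimes> inv h \<in> H"
      then have "inv h \<otimes> (h \<otimes> x \<otimes> inv h) \<otimes> h \<in> H" using h by blast
      moreover have "inv h \<otimes> (h \<otimes> x \<otimes> inv h) \<otimes> h = x"
        using h x by (simp add: m_assoc) (simp add: m_assoc[symmetric])
      ultimately show False using False by simp
    qed
    then show ?thesis using False out by simp
  qed
  define M where "M g = mat d d (\<lambda>(i,j). \<theta> (t i \<otimes> g \<otimes> inv (t j)))" for g
  have "is_rep G d M"
    unfolding is_rep_def
  proof (intro conjI ballI)
    show "M \<one> = 1\<^sub>m d"
    proof (rule eq_matI)
      fix i j assume "i < dim_row (1\<^sub>m d :: complex mat)" "j < dim_col (1\<^sub>m d :: complex mat)"
      then have ij: "i < d" "j < d" by auto
      have "\<theta> (t i \<otimes> inv (t j)) = (if i = j then 1 else 0)"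
      proof (cases "i = j")
        case False
        have "t i \<otimes> inv (t j) \<notin> H"
          using Ju[OF t[OF ij(1)] ij(1)] Ju[OF t[OF ij(1)] ij(2)] t[OF ij(1)] False by auto
        then show ?thesis using False out by simp
      qed (use t ij one in simp)
      then show "M \<one> $$ (i,j) = 1\<^sub>m d $$ (i,j)" using ij t by (simp add: M_def)
    qed (auto simp: M_def)
    fix g assume g: "g \<in> carrier G"
    show "M g \<in> carrier_mat d d" by (simp add: M_def)
    fix h assume h: "h \<in> carrier G"
    show "M (g \<otimes> h) = M g * M h"
    proof (rule eq_matI)
      fix i k assume "i < dim_row (M g * M h)" "k < dim_col (M g * M h)"
      then have ik: "i < d" "k < d" by (auto simp: M_def)
      let ?x = "t i \<otimes> g"
      have x: "?x \<in> carrier G" using t ik g by simp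
      let ?j = "J ?x"
      have "(M g * M h) $$ (i,k) = (\<Sum>j<d. \<theta> (?x \<otimes> inv (t j)) * \<theta> (t j \<otimes> h \<otimes> inv (t k)))"
        using ik by (subst mult_mat_entry[of _ d d _ d]) (auto simp: M_def)
      \<comment> \<open>The matrices are monomial: in row i only the index of the coset of
        \<open>t i \<otimes> g\<close> can give an argument inside H.\<close>
      also have "\<dots> = (\<Sum>j\<in>{?j}. \<theta> (?x \<otimes> inv (t j)) * \<theta> (t j \<otimes> h \<otimes> inv (t k)))"
      proof (intro sum.mono_neutral_right ballI)
        show "\<theta> (?x \<otimes> inv (t j)) * \<theta> (t j \<otimes> h \<otimes> inv (t k)) = 0" if "j \<in> {..<d} - {?j}" for j
          using Ju[OF x, of j] out[of "?x \<otimes> inv (t j)"] that by auto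
      qed (use J[OF x] in auto)
      also have "\<dots> = \<theta> ((?x \<otimes> inv (t ?j)) \<otimes> (t ?j \<otimes> h \<otimes> inv (t k)))"
        using J[OF x] t ik h by (simp add: \<theta>l)
      also have "(?x \<otimes> inv (t ?j)) \<otimes> (t ?j \<otimes> h \<otimes> inv (t k)) = t i \<otimes> (g \<otimes> h) \<otimes> inv (t k)"
      proof -
        have c: "t ?j \<in> carrier G" "t i \<in> carrier G" "t k \<in> carrier G" using t J[OF x] ik by auto
        have "inv (t ?j) \<otimes> (t ?j \<otimes> (h \<otimes> inv (t k))) = h \<otimes> inv (t k)"
          using c h by (simp add: m_assoc[symmetric])
        then show ?thesis using c g h by (simp add: m_assoc)
      qed
      finally show "M (g \<otimes> h) $$ (i,k) = (M g * M h) $$ (i,k)" using ik by (simp add: M_def)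
    qed (auto simp: M_def)
  qed
  moreover have "Ind G H \<theta> = char_of G d M"
  proof
    fix g
    show "Ind G H \<theta> g = char_of G d M g"
    proof (cases "g \<in> carrier G")
      case g: True
      let ?F = "\<lambda>x. \<theta> (x \<otimes> g \<otimes> inv x)"
      have "(\<Sum>x\<in>{x \<in> carrier G. x \<otimes> g \<otimes> inv x \<in> H}. ?F x) = (\<Sum>x\<in>carrier G. ?F x)"
        using fin out by (intro sum.mono_neutral_left) auto
      \<comment> \<open>Every group element is \<open>h \<otimes> t j\<close> for exactly one pair
        (j,h).\<close>
      also have "\<dots> = (\<Sum>(j,h)\<in>{..<d} \<times> H. ?F (h \<otimes> t j))"
      proof (rule sum.reindex_bij_witness[of _ "\<lambda>(j,h). h \<otimes> t j" "\<lambda>x. (J x, x \<otimes> inv (t (J x)))"])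
        fix x assume x: "x \<in> carrier G"
        note tJ = t[OF J(1)[OF x]]
        show "(J x, x \<otimes> inv (t (J x))) \<in> {..<d} \<times> H" using J[OF x] by simp
        show *: "(case (J x, x \<otimes> inv (t (J x))) of (j,h) \<Rightarrow> h \<otimes> t j) = x"
          using x tJ by (simp add: m_assoc)
        show "(case (J x, x \<otimes> inv (t (J x))) of (j,h) \<Rightarrow> ?F (h \<otimes> t j)) = ?F x" using * by simp
      next
        fix p assume "p \<in> {..<d} \<times> H"
        then obtain j h where p: "p = (j,h)" "j < d" "h \<in> H" by auto
        have c: "h \<otimes> t j \<in> carrier G" using p t by simp
        have e: "h \<otimes> t j \<otimes> inv (t j) = h" using p t by (simp add: m_assoc)
        then have "J (h \<otimes> t j) = j" using Ju[OF c p(2)] p(3) by simp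
        then show "(J (case p of (j,h) \<Rightarrow> h \<otimes> t j),
            (case p of (j,h) \<Rightarrow> h \<otimes> t j) \<otimes> inv (t (J (case p of (j,h) \<Rightarrow> h \<otimes> t j)))) = p"
          using p e by simp
        show "(case p of (j,h) \<Rightarrow> h \<otimes> t j) \<in> carrier G" using p c by simp
      qed
      also have "\<dots> = (\<Sum>j<d. \<Sum>h\<in>H. ?F (h \<otimes> t j))" by (simp add: sum.cartesian_product)
      also have "\<dots> = (\<Sum>j<d. \<Sum>h\<in>H. ?F (t j))"
      proof (intro sum.cong refl)
        fix j h assume "j \<in> {..<d}" and h: "h \<in> H"
        then have tj: "t j \<in> carrier G" using t by simp
        have "h \<otimes> t j \<otimes> g \<otimes> inv (h \<otimes> t j) = h \<otimes> (t j \<otimes> g \<otimes> inv (t j)) \<otimes> inv h"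
          using h tj g by (simp add: inv_mult_group m_assoc)
        then show "?F (h \<otimes> t j) = ?F (t j)" using \<theta>c[OF h] tj g by simp
      qed
      also have "\<dots> = of_nat (card H) * (\<Sum>j<d. ?F (t j))" by (simp add: sum_distrib_left)
      finally have "(\<Sum>x\<in>{x \<in> carrier G. x \<otimes> g \<otimes> inv x \<in> H}. ?F x) = of_nat (card H) * (\<Sum>j<d. ?F (t j))" .
      moreover have "card H \<noteq> 0" using finH H.one_closed by (metis card_0_eq empty_iff)
      ultimately show ?thesis using g by (simp add: Ind_def char_of_def M_def)
    qed (simp add: Ind_def char_of_def)
  qed
  moreover have "d \<ge> 1" using J(1)[OF one_closed] by simp
  ultimately show ?thesis unfolding is_character_def by blast
qed

end

section \<open>Frobenius reciprocity and Fourier expansion on cyclic subgroups\<close>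

lemma sum_roots_of_unity_power:
  fixes z :: complex
  assumes "z ^ N = 1"
  shows "(\<Sum>k<N. z ^ k) = (if z = 1 then of_nat N else 0)"
  using assms by (simp add: geometric_sum)

text \<open>Used to pass from a list of irreducible constituents to their multiplicities.\<close>

lemma sum_list_eq_count_list_sum:
  fixes f :: "'b \<Rightarrow> 'c :: comm_semiring_1"
  assumes "finite A" "set xs \<subseteq> A"
  shows "(\<Sum>x\<leftarrow>xs. f x) = (\<Sum>x\<in>A. of_nat (count_list xs x) * f x)"
  using assms(2)
proof (induction xs)
  case (Cons y xs)
  have "(\<Sum>x\<in>A. of_nat (count_list (y # xs) x) * f x) =
    (\<Sum>x\<in>A. (if x = y then f x else 0) + of_nat (count_list xs x) * f x)"
    by (intro sum.cong refl) (auto simp: algebra_simps)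
  also have "\<dots> = f y + (\<Sum>x\<in>A. of_nat (count_list xs x) * f x)"
    using Cons.prems assms(1) by (simp add: sum.distrib)
  finally show ?case using Cons by simp
qed simp

context group
begin

text \<open>Frobenius reciprocity with denominators cleared. The class function f will be a
  conjugated irreducible character.\<close>

lemma Ind_Frobenius:
  assumes fin: "finite (carrier G)" and H: "H \<subseteq> carrier G"
    and f: "\<And>y x. y \<in> carrier G \<Longrightarrow> x \<in> carrier G \<Longrightarrow> f (y \<otimes> x \<otimes> inv y) = f x"
  shows "of_nat (card H) * (\<Sum>x\<in>carrier G. Ind G H \<phi> x * f x) =
    of_nat (card (carrier G)) * (\<Sum>h\<in>H. \<phi> h * f h)"
proof (cases "H = {}")
  case False
  \<comment> \<open>This cancels the denominator in \<open>Ind\<close>; for empty H both sides are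
    0.\<close>
  then have "card H \<noteq> 0" using H fin by (auto dest: finite_subset)
  then have "of_nat (card H) * (\<Sum>x\<in>carrier G. Ind G H \<phi> x * f x) =
      (\<Sum>x\<in>carrier G. (\<Sum>y\<in>{y \<in> carrier G. y \<otimes> x \<otimes> inv y \<in> H}. \<phi> (y \<otimes> x \<otimes> inv y)) * f x)"
    unfolding sum_distrib_left by (intro sum.cong) (auto simp: Ind_def)
  \<comment> \<open>As f is a class function, it may be evaluated at the conjugate too, so the whole
    summand depends only on \<open>y \<otimes> x \<otimes> inv y\<close>.\<close>
  also have "\<dots> = (\<Sum>x\<in>carrier G. \<Sum>y\<in>carrier G.
      if y \<otimes> x \<otimes> inv y \<in> H then \<phi> (y \<otimes> x \<otimes> inv y) * f (y \<otimes> x \<otimes> inv y) else 0)"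
    unfolding sum.inter_filter[OF fin, symmetric] sum_distrib_right
    using f by (intro sum.cong refl) auto
  also have "\<dots> = (\<Sum>y\<in>carrier G. \<Sum>x\<in>carrier G.
      if y \<otimes> x \<otimes> inv y \<in> H then \<phi> (y \<otimes> x \<otimes> inv y) * f (y \<otimes> x \<otimes> inv y) else 0)"
    by (rule sum.swap)
  \<comment> \<open>Conjugation by a fixed y permutes the group, so the inner sum is independent of
    y; the outer sum then supplies the factor \<open>card (carrier G)\<close>.\<close>
  also have "\<dots> = (\<Sum>y\<in>carrier G. \<Sum>x\<in>carrier G. if x \<in> H then \<phi> x * f x else 0)"
  proof (rule sum.cong[OF refl])
    fix y assume y: "y \<in> carrier G"
    show "(\<Sum>x\<in>carrier G. if y \<otimes> x \<otimes> inv y \<in> H then \<phi> (y \<otimes> x \<otimes> inv y) * f (y \<otimes> x \<otimes> inv y) else 0)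
      = (\<Sum>x\<in>carrier G. if x \<in> H then \<phi> x * f x else 0)"
    proof (rule sum.reindex_bij_witness[of _ "\<lambda>x. inv y \<otimes> x \<otimes> y" "\<lambda>x. y \<otimes> x \<otimes> inv y"])
      fix x assume x: "x \<in> carrier G"
      have "inv y \<otimes> (y \<otimes> x \<otimes> inv y) \<otimes> y = (inv y \<otimes> y) \<otimes> x \<otimes> (inv y \<otimes> y)"
        using x y by (simp only: m_assoc m_closed inv_closed)
      then show "inv y \<otimes> (y \<otimes> x \<otimes> inv y) \<otimes> y = x" using x y by simp
      have "y \<otimes> (inv y \<otimes> x \<otimes> y) \<otimes> inv y = (y \<otimes> inv y) \<otimes> x \<otimes> (y \<otimes> inv y)"
        using x y by (simp only: m_assoc m_closed inv_closed)
      then show "y \<otimes> (inv y \<otimes> x \<otimes> y) \<otimes> inv y = x" using x y by simp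
    qed (use y in auto)
  qed
  also have "\<dots> = of_nat (card (carrier G)) * (\<Sum>h\<in>H. \<phi> h * f h)"
    using H fin by (simp add: sum.inter_restrict[symmetric] Int_absorb1)
  finally show ?thesis .
qed simp

lemma generate_sum_powers:
  assumes fin: "finite (carrier G)" and g: "g \<in> carrier G"
  shows "(\<Sum>h\<in>generate G {g}. F h) = (\<Sum>k<ord g. F (g [^] k))"
proof -
  have pos: "ord g \<ge> 1" by (rule ord_ge_1[OF fin g])
  then have s: "{0..ord g - 1} = {..<ord g}" by auto
  have "generate G {g} = (\<lambda>k. g [^] k) ` {..<ord g}"
    using generate_pow_on_finite_carrier[OF fin g] ord_elems[OF fin g] s by auto
  moreover have "inj_on (\<lambda>k. g [^] k) {..<ord g}" using ord_inj[OF g] s by simp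
  ultimately show ?thesis by (simp add: sum.reindex)
qed

text \<open>Fourier inversion on the cyclic group generated by g: the inner sum is
  \<open>ord g\<close> times the multiplicity of \<omega> among the eigenvalues of
  \<open>\<rho> g\<close>.\<close>

lemma char_of_eq_root_sum:
  assumes fin: "finite (carrier G)" and \<rho>: "is_rep G d \<rho>" and g: "g \<in> carrier G"
  shows "of_nat (ord g) * char_of G d \<rho> (g [^] (l::nat)) =
    (\<Sum>\<omega> | \<omega> ^ ord g = 1. (\<Sum>h\<in>generate G {g}. cnj (lin_char G g \<omega> h) * char_of G d \<rho> h) * \<omega> ^ l)"
proof -
  let ?N = "ord g" and ?\<Omega> = "{\<omega>::complex. \<omega> ^ ord g = 1}"
  have pos: "?N > 0" using ord_ge_1[OF fin g] by simp
  have fin\<Omega>: "finite ?\<Omega>" using pos by (intro finite_roots_unity) simp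
  obtain e where e: "\<And>i. i < d \<Longrightarrow> e i ^ ?N = 1" "\<And>k. char_of G d \<rho> (g [^] (k::nat)) = (\<Sum>i<d. e i ^ k)"
    using char_of_powers[OF \<rho> g] by blast
  have m: "(\<Sum>h\<in>generate G {g}. cnj (lin_char G g \<omega> h) * char_of G d \<rho> h) =
      (\<Sum>i<d. if e i = \<omega> then of_nat ?N else 0)" if \<omega>: "\<omega> \<in> ?\<Omega>" for \<omega>
  proof -
    have \<omega>1: "\<omega> ^ ?N = 1" using \<omega> by simp
    have "cmod \<omega> = 1" by (rule root_of_unity_norm[OF \<omega>1 pos])
    then have wc: "\<omega> * cnj \<omega> = 1" by (simp add: complex_norm_square[symmetric])
    have "(\<Sum>h\<in>generate G {g}. cnj (lin_char G g \<omega> h) * char_of G d \<rho> h) =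
      (\<Sum>k<?N. \<Sum>i<d. (cnj \<omega> * e i) ^ k)"
      by (simp add: generate_sum_powers[OF fin g] lin_char_pow[OF fin g \<omega>1] e(2) sum_distrib_left power_mult_distrib)
    also have "\<dots> = (\<Sum>i<d. \<Sum>k<?N. (cnj \<omega> * e i) ^ k)" by (rule sum.swap)
    also have "\<dots> = (\<Sum>i<d. if e i = \<omega> then of_nat ?N else 0)"
    proof (rule sum.cong[OF refl])
      fix i assume "i \<in> {..<d}"
      then have "e i ^ ?N = 1" using e(1) by simp
      moreover have "cnj \<omega> ^ ?N = 1" using \<omega>1 by (metis complex_cnj_one complex_cnj_power)
      ultimately have "(cnj \<omega> * e i) ^ ?N = 1" by (simp add: power_mult_distrib)
      \<comment> \<open>Hence the geometric sum over powers of this root of unity detects whether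
        \<open>e i\<close> equals \<omega>.\<close>
      moreover have "cnj \<omega> * e i = 1 \<longleftrightarrow> e i = \<omega>"
        using wc by (metis mult.assoc mult.commute mult.left_neutral)
      ultimately show "(\<Sum>k<?N. (cnj \<omega> * e i) ^ k) = (if e i = \<omega> then of_nat ?N else 0)"
        by (simp add: sum_roots_of_unity_power)
    qed
    finally show ?thesis .
  qed
  have "(\<Sum>\<omega>\<in>?\<Omega>. (\<Sum>h\<in>generate G {g}. cnj (lin_char G g \<omega> h) * char_of G d \<rho> h) * \<omega> ^ l) =
      (\<Sum>\<omega>\<in>?\<Omega>. \<Sum>i<d. if e i = \<omega> then of_nat ?N * e i ^ l else 0)"
    by (rule sum.cong[OF refl]) (auto simp: m sum_distrib_right intro!: sum.cong)
  also have "\<dots> = (\<Sum>i<d. \<Sum>\<omega>\<in>?\<Omega>. if e i = \<omega> then of_nat ?N * e i ^ l else 0)" by (rule sum.swap)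
  also have "\<dots> = (\<Sum>i<d. of_nat ?N * e i ^ l)"
    using fin\<Omega> e(1) by (intro sum.cong refl) simp
  finally show ?thesis by (simp add: e(2) sum_distrib_left)
qed

end

section \<open>The Heilbronn character\<close>

definition char_additive :: "('a, 'b) monoid_scheme \<Rightarrow> (('a \<Rightarrow> complex) \<Rightarrow> int) \<Rightarrow> bool" where
  "char_additive G N \<longleftrightarrow> (\<forall>\<phi>1 \<phi>2. is_character G \<phi>1 \<longrightarrow> is_character G \<phi>2 \<longrightarrow>
     N (\<lambda>h. \<phi>1 h + \<phi>2 h) = N \<phi>1 + N \<phi>2)"

context group
begin

text \<open>The list must be nonempty: the zero function is not a character, so additivity gives no
  value for the empty sum.\<close>

lemma additive_sum_list:
  fixes N :: "('a \<Rightarrow> complex) \<Rightarrow> int"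
  assumes add: "char_additive G N"
    and "xs \<noteq> []" "\<And>\<chi>. \<chi> \<in> set xs \<Longrightarrow> is_character G \<chi>"
  shows "is_character G (\<lambda>g. \<Sum>\<chi>\<leftarrow>xs. \<chi> g) \<and> N (\<lambda>g. \<Sum>\<chi>\<leftarrow>xs. \<chi> g) = (\<Sum>\<chi>\<leftarrow>xs. N \<chi>)"
  using assms(2,3)
proof (induction xs rule: list_nonempty_induct)
  case (cons x xs)
  have x: "is_character G x" using cons.prems by simp
  have "is_character G (\<lambda>g. \<Sum>\<chi>\<leftarrow>xs. \<chi> g) \<and> N (\<lambda>g. \<Sum>\<chi>\<leftarrow>xs. \<chi> g) = (\<Sum>\<chi>\<leftarrow>xs. N \<chi>)"
    using cons.prems by (intro cons.IH) simp
  then show ?case using add x is_character_add[OF x] by (simp add: char_additive_def)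
qed simp

text \<open>Additivity expresses \<open>N \<phi>\<close> through the multiplicities of the
  irreducible constituents, and orthonormality recovers these as inner products, here scaled by the
  group order.\<close>

lemma additive_eq_inner_product:
  fixes N :: "('a \<Rightarrow> complex) \<Rightarrow> int"
  assumes fin: "finite (carrier G)" and finI: "finite (Irr G)"
    and add: "char_additive G N"
    and \<phi>: "is_character G \<phi>"
  shows "of_nat (card (carrier G)) * of_int (N \<phi>) =
    (\<Sum>\<chi>\<in>Irr G. (\<Sum>g\<in>carrier G. \<phi> g * cnj (\<chi> g)) * of_int (N \<chi>))"
proof -
  obtain xs where xs: "xs \<noteq> []" "set xs \<subseteq> Irr G" "\<phi> = (\<lambda>g. \<Sum>\<chi>\<leftarrow>xs. \<chi> g)"
    using \<phi> char_of_sum_Irr unfolding is_character_def by metis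
  have ip: "(\<Sum>g\<in>carrier G. \<phi> g * cnj (\<chi> g)) = of_nat (card (carrier G)) * of_nat (count_list xs \<chi>)"
    if \<chi>: "\<chi> \<in> Irr G" for \<chi>
  proof -
    have "(\<Sum>g\<in>carrier G. \<phi> g * cnj (\<chi> g)) =
      (\<Sum>g\<in>carrier G. \<Sum>\<psi>\<in>Irr G. of_nat (count_list xs \<psi>) * (\<psi> g * cnj (\<chi> g)))"
      unfolding xs(3) sum_list_eq_count_list_sum[OF finI xs(2)] by (simp add: sum_distrib_right mult.assoc)
    also have "\<dots> = (\<Sum>\<psi>\<in>Irr G. of_nat (count_list xs \<psi>) * (\<Sum>g\<in>carrier G. \<psi> g * cnj (\<chi> g)))"
      by (subst sum.swap) (simp add: sum_distrib_left)
    also have "\<dots> = (\<Sum>\<psi>\<in>Irr G. if \<psi> = \<chi> then of_nat (card (carrier G)) * of_nat (count_list xs \<chi>) else 0)"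
      by (intro sum.cong refl) (auto simp: Irr_orthonormal[OF fin _ \<chi>])
    finally show ?thesis using \<chi> finI by simp
  qed
  have "N \<phi> = (\<Sum>\<chi>\<leftarrow>xs. N \<chi>)"
    using additive_sum_list[OF add xs(1)] xs(2,3) Irr_is_character by blast
  also have "\<dots> = (\<Sum>\<chi>\<in>Irr G. of_nat (count_list xs \<chi>) * N \<chi>)"
    by (rule sum_list_eq_count_list_sum[OF finI xs(2)])
  finally show ?thesis by (simp add: ip sum_distrib_left mult.assoc)
qed

text \<open>\<open>N\<close> is additive over characters, so the coefficients of
  \<open>Reg G\<close>, which are degrees, are realised as repetitions in a list. Positive degrees
  and a nonempty \<open>Irr G\<close> keep that list nonempty.\<close>

lemma additive_Reg:
  fixes N :: "('a \<Rightarrow> complex) \<Rightarrow> int"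
  assumes finI: "finite (Irr G)" "Irr G \<noteq> {}"
    and add: "char_additive G N"
  shows "of_int (N (Reg G)) = (\<Sum>\<chi>\<in>Irr G. of_int (N \<chi>) * \<chi> \<one>)"
proof -
  have "\<exists>d. d \<ge> 1 \<and> \<chi> \<one> = of_nat d" if "\<chi> \<in> Irr G" for \<chi> :: "'a \<Rightarrow> complex"
    using that char_of_one unfolding Irr_def irreducible_rep_def by auto
  then obtain deg where deg: "\<And>\<chi>. \<chi> \<in> Irr G \<Longrightarrow> deg \<chi> \<ge> 1 \<and> \<chi> \<one> = of_nat (deg \<chi>)" by metis
  obtain ys where ys: "set ys = Irr G" "distinct ys" using finite_distinct_list[OF finI(1)] by blast
  define xs where "xs = concat (map (\<lambda>\<chi>. replicate (deg \<chi>) \<chi>) ys)"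
  have sl: "(\<Sum>\<chi>\<leftarrow>xs. F \<chi>) = (\<Sum>\<chi>\<in>Irr G. of_nat (deg \<chi>) * F \<chi>)"
    for F :: "('a \<Rightarrow> complex) \<Rightarrow> 'c :: comm_semiring_1"
  proof -
    have "(\<Sum>\<chi>\<leftarrow>xs. F \<chi>) = (\<Sum>\<chi>\<leftarrow>ys. of_nat (deg \<chi>) * F \<chi>)"
      unfolding xs_def by (induction ys) (auto simp: sum_list_replicate)
    then show ?thesis using ys by (simp add: sum_list_distinct_conv_sum_set)
  qed
  have "set xs \<subseteq> set ys" unfolding xs_def by auto
  then have xsI: "set xs \<subseteq> Irr G" unfolding ys(1) .
  have "xs \<noteq> []"
  proof -
    obtain \<chi> where "\<chi> \<in> Irr G" using finI(2) by blast
    then have "\<chi> \<in> set xs" using deg[of \<chi>] ys(1) by (auto simp: xs_def)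
    then show ?thesis by auto
  qed
  moreover have "\<And>\<chi>. \<chi> \<in> set xs \<Longrightarrow> is_character G \<chi>" using xsI Irr_is_character by blast
  ultimately have "N (\<lambda>g. \<Sum>\<chi>\<leftarrow>xs. \<chi> g) = (\<Sum>\<chi>\<leftarrow>xs. N \<chi>)"
    using additive_sum_list[OF add] by simp
  moreover have "Reg G = (\<lambda>g. \<Sum>\<chi>\<leftarrow>xs. \<chi> g)"
    using deg by (auto simp: Reg_def sl intro!: sum.cong)
  ultimately have "N (Reg G) = (\<Sum>\<chi>\<leftarrow>xs. N \<chi>)" by simp
  then show ?thesis using deg by (simp add: sl mult.commute)
qed

end

section \<open>Mean square and pointwise bound of the Heilbronn character\<close>

theorem theorem5p1p3:
  fixes G :: "('a, 'b) monoid_scheme"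
    and n :: "'a set \<Rightarrow> ('a \<Rightarrow> complex) \<Rightarrow> int"
  assumes "group G" and "finite (carrier G)"
    and add: "\<And>H \<phi>1 \<phi>2. (cyclic_subgroup G H \<or> H = carrier G) \<Longrightarrow>
               is_character (G\<lparr>carrier := H\<rparr>) \<phi>1 \<Longrightarrow> is_character (G\<lparr>carrier := H\<rparr>) \<phi>2 \<Longrightarrow>
               n H (\<lambda>h. \<phi>1 h + \<phi>2 h) = n H \<phi>1 + n H \<phi>2"
    and ind: "\<And>H \<phi>. cyclic_subgroup G H \<Longrightarrow> is_character (G\<lparr>carrier := H\<rparr>) \<phi> \<Longrightarrow>
               n (carrier G) (Ind G H \<phi>) = n H \<phi>"
    and nonneg: "\<And>H \<phi>. cyclic_subgroup G H \<Longrightarrow> is_character (G\<lparr>carrier := H\<rparr>) \<phi> \<Longrightarrow>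
               n H \<phi> \<ge> 0"
  shows "(\<Sum>\<chi>\<in>Irr G. (n (carrier G) \<chi>)\<^sup>2) \<le> (n (carrier G) (Reg G))\<^sup>2"
proof (cases "finite (Irr G) \<and> Irr G \<noteq> {}")
  \<comment> \<open>Otherwise the left-hand side is \<open>0\<close>, as sums over infinite sets are \<open>0\<close> by convention.\<close>
  case True
  then have finI: "finite (Irr G)" "Irr G \<noteq> {}" by auto
  interpret group G by fact
  note fin = \<open>finite (carrier G)\<close>
  let ?N = "n (carrier G)" and ?c = "of_nat (card (carrier G)) :: complex"
  have c0: "card (carrier G) > 0" using fin by (auto simp: card_gt_0_iff)
  have addG: "char_additive G ?N"
    using add[of "carrier G"] by (simp add: char_additive_def)
  define \<Theta> where "\<Theta> x = (\<Sum>\<chi>\<in>Irr G. of_int (?N \<chi>) * \<chi> x)" for x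
  have \<Theta>1: "\<Theta> \<one>\<^bsub>G\<^esub> = of_int (?N (Reg G))"
    using additive_Reg[OF finI addG] unfolding \<Theta>_def by simp
  have norm: "?c * of_int (\<Sum>\<chi>\<in>Irr G. (?N \<chi>)\<^sup>2) = (\<Sum>x\<in>carrier G. \<Theta> x * cnj (\<Theta> x))"
  proof -
    have "(\<Sum>x\<in>carrier G. \<Theta> x * cnj (\<Theta> x)) =
      (\<Sum>x\<in>carrier G. \<Sum>\<chi>\<in>Irr G. \<Sum>\<psi>\<in>Irr G. of_int (?N \<chi>) * of_int (?N \<psi>) * (\<chi> x * cnj (\<psi> x)))"
      unfolding \<Theta>_def by (simp add: sum_product cnj_sum mult.assoc mult.left_commute)
    also have "\<dots> = (\<Sum>\<chi>\<in>Irr G. \<Sum>\<psi>\<in>Irr G. of_int (?N \<chi>) * of_int (?N \<psi>) * (\<Sum>x\<in>carrier G. \<chi> x * cnj (\<psi> x)))"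
      by (subst sum.swap) (simp add: sum.swap[of _ _ "carrier G"] sum_distrib_left)
    also have "\<dots> = (\<Sum>\<chi>\<in>Irr G. \<Sum>\<psi>\<in>Irr G. if \<chi> = \<psi> then ?c * of_int ((?N \<chi>)\<^sup>2) else 0)"
      by (intro sum.cong refl) (auto simp: Irr_orthonormal[OF fin] power2_eq_square)
    also have "\<dots> = (\<Sum>\<chi>\<in>Irr G. ?c * of_int ((?N \<chi>)\<^sup>2))" using finI by simp
    finally show ?thesis by (simp add: sum_distrib_left)
  qed
  \<comment> \<open>The absolute value on the right allows the bound to be squared directly.\<close>
  have bound: "cmod (\<Theta> g) \<le> \<bar>of_int (?N (Reg G))\<bar>" if g: "g \<in> carrier G" for g
  proof -
    let ?H = "generate G {g}" and ?\<Omega> = "{\<omega>::complex. \<omega> ^ ord g = 1}"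
    let ?o = "of_nat (ord g) :: complex"
    have pos: "ord g > 0" using ord_ge_1[OF fin g] by simp
    have H: "subgroup ?H G" using g by (intro generate_is_subgroup) auto
    have cyc: "cyclic_subgroup G ?H" using g unfolding cyclic_subgroup_def by blast
    define m where "m \<omega> = n ?H (lin_char G g \<omega>)" for \<omega>
    have m: "m \<omega> \<ge> 0" if "\<omega> \<in> ?\<Omega>" for \<omega>
      using nonneg[OF cyc] is_character_lin_char[OF fin g] that by (simp add: m_def)
    \<comment> \<open>By invariance under induction \<open>m \<omega>\<close> is a value of
      \<open>?N\<close>, hence a combination of inner products over G. Frobenius reciprocity moves
      these to the cyclic subgroup, and the order of G cancels.\<close>
    have mf: "?o * of_int (m \<omega>) =
        (\<Sum>\<chi>\<in>Irr G. (\<Sum>h\<in>?H. lin_char G g \<omega> h * cnj (\<chi> h)) * of_int (?N \<chi>))" if \<omega>: "\<omega> \<in> ?\<Omega>" for \<omega>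
    proof -
      have \<omega>1: "\<omega> ^ ord g = 1" using \<omega> by simp
      let ?\<phi> = "lin_char G g \<omega>"
      \<comment> \<open>Expansion by inner products applies only to genuine characters, so the
        induced function must be realised by a representation.\<close>
      have "is_character G (Ind G ?H ?\<phi>)"
        using lin_char_mult[OF fin g \<omega>1] lin_char_one[OF fin g \<omega>1]
        by (intro is_character_Ind_linear[OF fin H]) (auto simp: lin_char_def)
      then have "?c * of_int (?N (Ind G ?H ?\<phi>)) =
        (\<Sum>\<chi>\<in>Irr G. (\<Sum>x\<in>carrier G. Ind G ?H ?\<phi> x * cnj (\<chi> x)) * of_int (?N \<chi>))"
        by (rule additive_eq_inner_product[OF fin finI(1) addG])
      moreover have "?N (Ind G ?H ?\<phi>) = m \<omega>"
        using ind[OF cyc is_character_lin_char[OF fin g \<omega>1]] by (simp add: m_def)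
      ultimately have "?c * of_int (m \<omega>) =
        (\<Sum>\<chi>\<in>Irr G. (\<Sum>x\<in>carrier G. Ind G ?H ?\<phi> x * cnj (\<chi> x)) * of_int (?N \<chi>))" by simp
      then have "?c * (?o * of_int (m \<omega>)) =
        ?o * (\<Sum>\<chi>\<in>Irr G. (\<Sum>x\<in>carrier G. Ind G ?H ?\<phi> x * cnj (\<chi> x)) * of_int (?N \<chi>))"
        by (metis mult.left_commute)
      also have "\<dots> = (\<Sum>\<chi>\<in>Irr G. (?o * (\<Sum>x\<in>carrier G. Ind G ?H ?\<phi> x * cnj (\<chi> x))) * of_int (?N \<chi>))"
        by (simp only: sum_distrib_left[of ?o _ "Irr G"] mult.assoc)
      also have "\<dots> = (\<Sum>\<chi>\<in>Irr G. (?c * (\<Sum>h\<in>?H. ?\<phi> h * cnj (\<chi> h))) * of_int (?N \<chi>))"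
      proof (rule sum.cong[OF refl])
        fix \<chi> assume "\<chi> \<in> Irr G"
        then obtain d \<rho> where "is_rep G d \<rho>" "\<chi> = char_of G d \<rho>" unfolding Irr_def irreducible_rep_def by blast
        then have cj: "cnj (\<chi> (y \<otimes>\<^bsub>G\<^esub> x \<otimes>\<^bsub>G\<^esub> inv\<^bsub>G\<^esub> y)) = cnj (\<chi> x)" if "y \<in> carrier G" "x \<in> carrier G" for x y
          using char_of_conj that by simp
        from Ind_Frobenius[where f="\<lambda>x. cnj (\<chi> x)" and \<phi>="?\<phi>", OF fin subgroup.subset[OF H] cj]
        show "(?o * (\<Sum>x\<in>carrier G. Ind G ?H ?\<phi> x * cnj (\<chi> x))) * of_int (?N \<chi>) =
          (?c * (\<Sum>h\<in>?H. ?\<phi> h * cnj (\<chi> h))) * of_int (?N \<chi>)"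
          using generate_pow_card[OF g] by simp
      qed
      also have "\<dots> = ?c * (\<Sum>\<chi>\<in>Irr G. (\<Sum>h\<in>?H. ?\<phi> h * cnj (\<chi> h)) * of_int (?N \<chi>))"
        by (simp only: sum_distrib_left[of ?c _ "Irr G"] mult.assoc)
      finally show ?thesis using c0 by simp
    qed
    \<comment> \<open>The expansion of \<Theta> on the powers of g, with coefficients
      \<open>m \<omega>\<close>. The exponent is kept general because l = 1 gives the value at g and
      l = 0 the value at the identity.\<close>
    have \<Theta>f: "\<Theta> (g [^]\<^bsub>G\<^esub> l) = (\<Sum>\<omega>\<in>?\<Omega>. of_int (m \<omega>) * \<omega> ^ l)" for l :: nat
    proof -
      have "?o * \<Theta> (g [^]\<^bsub>G\<^esub> l) = (\<Sum>\<chi>\<in>Irr G. of_int (?N \<chi>) * (?o * \<chi> (g [^]\<^bsub>G\<^esub> l)))"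
        unfolding \<Theta>_def by (simp add: sum_distrib_left mult_ac)
      also have "\<dots> = (\<Sum>\<chi>\<in>Irr G. of_int (?N \<chi>) *
          (\<Sum>\<omega>\<in>?\<Omega>. (\<Sum>h\<in>?H. cnj (lin_char G g \<omega> h) * \<chi> h) * \<omega> ^ l))"
      proof (rule sum.cong[OF refl])
        fix \<chi> assume "\<chi> \<in> Irr G"
        then obtain d \<rho> where \<rho>: "is_rep G d \<rho>" "\<chi> = char_of G d \<rho>" unfolding Irr_def irreducible_rep_def by blast
        show "of_int (?N \<chi>) * (?o * \<chi> (g [^]\<^bsub>G\<^esub> l)) = of_int (?N \<chi>) *
          (\<Sum>\<omega>\<in>?\<Omega>. (\<Sum>h\<in>?H. cnj (lin_char G g \<omega> h) * \<chi> h) * \<omega> ^ l)"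
          using char_of_eq_root_sum[OF fin \<rho>(1) g, of l] \<rho>(2) by simp
      qed
      also have "\<dots> = (\<Sum>\<chi>\<in>Irr G. \<Sum>\<omega>\<in>?\<Omega>.
          (\<Sum>h\<in>?H. cnj (lin_char G g \<omega> h) * \<chi> h) * of_int (?N \<chi>) * \<omega> ^ l)"
        unfolding sum_distrib_left[of _ _ ?\<Omega>] by (intro sum.cong refl) (simp only: mult_ac)
      also have "\<dots> = (\<Sum>\<omega>\<in>?\<Omega>. \<Sum>\<chi>\<in>Irr G.
          (\<Sum>h\<in>?H. cnj (lin_char G g \<omega> h) * \<chi> h) * of_int (?N \<chi>) * \<omega> ^ l)"
        by (rule sum.swap)
      also have "\<dots> = (\<Sum>\<omega>\<in>?\<Omega>. (\<Sum>\<chi>\<in>Irr G. (\<Sum>h\<in>?H. cnj (lin_char G g \<omega> h) * \<chi> h) * of_int (?N \<chi>)) * \<omega> ^ l)"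
        by (simp only: sum_distrib_right[of _ "Irr G"])
      also have "\<dots> = (\<Sum>\<omega>\<in>?\<Omega>. ?o * of_int (m \<omega>) * \<omega> ^ l)"
      proof (rule sum.cong[OF refl])
        fix \<omega> assume "\<omega> \<in> ?\<Omega>"
        \<comment> \<open>In \<open>mf\<close> the irreducible character is conjugated, here the
          linear one is. Since \<open>m \<omega>\<close> and the values of \<open>?N\<close> are
          integers, conjugating \<open>mf\<close> exchanges the two forms.\<close>
        from arg_cong[OF mf[OF this], of cnj]
        show "(\<Sum>\<chi>\<in>Irr G. (\<Sum>h\<in>?H. cnj (lin_char G g \<omega> h) * \<chi> h) * of_int (?N \<chi>)) * \<omega> ^ l =
          ?o * of_int (m \<omega>) * \<omega> ^ l" by (simp add: cnj_sum)
      qed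
      also have "\<dots> = ?o * (\<Sum>\<omega>\<in>?\<Omega>. of_int (m \<omega>) * \<omega> ^ l)" by (simp add: sum_distrib_left mult.assoc)
      finally show ?thesis using pos by simp
    qed
    have "cmod (\<Theta> g) = cmod (\<Sum>\<omega>\<in>?\<Omega>. of_int (m \<omega>) * \<omega>)" using \<Theta>f[of 1] g by simp
    also have "\<dots> \<le> (\<Sum>\<omega>\<in>?\<Omega>. cmod (of_int (m \<omega>) * \<omega>))" by (rule norm_sum)
    also have "\<dots> = (\<Sum>\<omega>\<in>?\<Omega>. of_int (m \<omega>))"
    proof (rule sum.cong[OF refl])
      fix \<omega> assume \<omega>: "\<omega> \<in> ?\<Omega>"
      then have "cmod \<omega> = 1" using root_of_unity_norm[OF _ pos] by simp
      then show "cmod (of_int (m \<omega>) * \<omega>) = of_int (m \<omega>)" using m[OF \<omega>] by (simp add: norm_mult)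
    qed
    also have "\<dots> = of_int (\<Sum>\<omega>\<in>?\<Omega>. m \<omega>)" by simp
    \<comment> \<open>At exponent 0 all powers of \<omega> are 1, so the coefficients add up to
      \<Theta> at the identity.\<close>
    also have "(\<Sum>\<omega>\<in>?\<Omega>. m \<omega>) = ?N (Reg G)"
    proof -
      have "of_int (\<Sum>\<omega>\<in>?\<Omega>. m \<omega>) = (of_int (?N (Reg G)) :: complex)"
        using \<Theta>f[of 0] \<Theta>1 by simp
      then show ?thesis by (simp only: of_int_eq_iff)
    qed
    finally show ?thesis by linarith
  qed
  have "of_nat (card (carrier G)) * of_int (\<Sum>\<chi>\<in>Irr G. (?N \<chi>)\<^sup>2) = (\<Sum>x\<in>carrier G. (cmod (\<Theta> x))\<^sup>2)"
  proof -
    \<comment> \<open>The norm identity is complex; both of its sides are real, so it is carried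
      back through the injective embedding of the reals.\<close>
    have "complex_of_real (of_nat (card (carrier G)) * of_int (\<Sum>\<chi>\<in>Irr G. (?N \<chi>)\<^sup>2)) =
      complex_of_real (\<Sum>x\<in>carrier G. (cmod (\<Theta> x))\<^sup>2)"
      using norm by (simp add: complex_norm_square del: of_int_sum of_real_power)
    then show ?thesis by (simp only: of_real_eq_iff)
  qed
  also have "\<dots> \<le> (\<Sum>x\<in>carrier G. (of_int (?N (Reg G)))\<^sup>2)"
    using bound by (intro sum_mono) (metis norm_ge_zero power2_abs power_mono)
  also have "\<dots> = of_nat (card (carrier G)) * of_int ((?N (Reg G))\<^sup>2)" by simp
  finally have "real_of_int (\<Sum>\<chi>\<in>Irr G. (?N \<chi>)\<^sup>2) \<le> real_of_int ((?N (Reg G))\<^sup>2)"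
    using c0 by (simp only: mult_le_cancel_left_pos of_nat_0_less_iff)
  then show ?thesis by (simp only: of_int_le_iff)
qed auto

end
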